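(* Let $\lambda\supseteq\mu$ be partitions and $\mathcal{I}$ an interval set of $\lambda/\mu$. Then, as $T$ ranges over all minimal border strip tableaux of shape $\lambda/\mu$ corresponding to $\mathcal{I}$ (there are $r!$ of them, $r=\mathrm{rank}(\lambda/\mu)$), the number of distinct border strip decompositions $D(T)$ obtained is $\mathrm{is}(\lambda/\mu)$.
   Context: Skew diagram $\lambda/\mu=\{(i,j):\mu_i<j\le\lambda_i\}$; square $(i,j)$ drawn as $[j-1,j]\times[-i,-i+1]$. $\mathrm{rank}(\lambda/\mu)$: an outside top corner is $(i,j)\in\lambda/\mu$ with $(i-1,j),(i,j-1)\notin\lambda/\mu$; an inside top corner is $(i,j)\in\lambda/\mu$ with $(i-1,j),(i,j-1)\in\lambda/\mu$, $(i-1,j-1)\notin\lambda/\mu$; the diagonal of corner $(i,j)$ is $\{(i+p,j+p)\in\lambda/\mu:p\ge0\}$; rank = number of squares on outside diagonals minus number on inside diagonals. A border strip is a nonempty edge-connected skew diagram with no $2\times2$ block; a border strip decomposition is a partition of the squares of $\lambda/\mu$ into border strips, minimal if it has fewest strips. A border strip tableau of shape $\lambda/\mu$ is a chain $\mu=\lambda^0\subset\cdots\subset\lambda^m=\lambda$ of partitions with each $\lambda^i/\lambda^{i-1}$ a border strip; $D(T)=\{\lambda^i/\lambda^{i-1}\}$; $T$ is minimal if $D(T)$ is. Code: for a partition $\alpha$, its boundary path goes up $x=0$ from $y=-\infty$ to $(0,-\ell(\alpha))$, follows the lower-right boundary of $\alpha$ to $(\alpha_1,0)$, then right along $y=0$;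 the step starting at $(x,y)$ has index $x+y$; $\mathrm{code}(\alpha)_k$ is $1$ if step $k$ is horizontal, $0$ if vertical. If $\beta\subseteq\alpha$ and $\alpha/\beta$ is a border strip of $p$ squares, then $\mathrm{code}(\alpha)$ and $\mathrm{code}(\beta)$ differ in exactly two positions $u<v=u+p$, with $\mathrm{code}(\alpha)_u=1,\mathrm{code}(\alpha)_v=0$. A tableau $T$ corresponds to the set $\mathcal{I}(T)$ of pairs $(u,v)$ so obtained from its steps $\lambda^{i-1}\subset\lambda^i$. Snakes and interval sets: for $k\in\mathbb{Z}$ let $e_k$ be step $k$ of the boundary path of $\lambda$. If $e_k$ is also a step of the path of $\mu$, $S_k=\emptyset$. Otherwise, if $e_k$ is horizontal it is the lower edge of $(i,j)\in\lambda/\mu$ and $S_k=(\lambda/\mu)\cap\{(i,j),(i,j-1),(i-1,j-1),(i-1,j-2),\dots\}$; if vertical it is the right edge of $(i,j)\in\lambda/\mu$ and $S_k=(\lambda/\mu)\cap\{(i,j),(i-1,j),(i-1,j-1),(i-2,j-1),\dots\}$. $\ell(S_k)=|S_k|-1$. $S_k$ is a left snake if $e_k$ horizontal and $\ell(S_k)\ge0$ even, a right snake if $e_k$ vertical and $\ell(S_k)\ge0$ even. An interval set is a set of $r$ pairs $(u_i,v_i)$ of integers, the $2r$ integers distinct, $u_i<v_i$, each $S_{u_i}$ a left snake and each $S_{v_i}$ a right snake. $\mathrm{is}(\lambda/\mu)$ is the number of interval sets. $T$ corresponds to $\mathcal{I}$ if $\mathcal{I}(T)=\mathcal{I}$. 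*)

theory Defs
  imports Main "HOL-Library.Disjoint_Sets"
begin

section \<open>Partitions, skew diagrams and rank\<close>

text \<open>A partition is stored as the sequence of its parts, indexed from \<open>1\<close>; the unused value at
  index \<open>0\<close> is fixed to \<open>0\<close>, so that equality of functions is equality of partitions.\<close>

definition is_partition :: "(nat \<Rightarrow> nat) \<Rightarrow> bool" where
  "is_partition \<alpha> \<longleftrightarrow>
     \<alpha> 0 = 0 \<and> (\<forall>i\<ge>1. \<alpha> (Suc i) \<le> \<alpha> i) \<and> finite {i. \<alpha> i \<noteq> 0}"

definition contained :: "(nat \<Rightarrow> nat) \<Rightarrow> (nat \<Rightarrow> nat) \<Rightarrow> bool" where
  "contained \<beta> \<alpha> \<longleftrightarrow> (\<forall>i. \<beta> i \<le> \<alpha> i)"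

text \<open>The square \<open>(i, j)\<close> lies in row \<open>i\<close> and column \<open>j\<close>, both counted from \<open>1\<close>.
  It is drawn as \<open>[j - 1, j] \<times> [-i, -i + 1]\<close>.\<close>

type_synonym square = "int \<times> int"

definition skew :: "(nat \<Rightarrow> nat) \<Rightarrow> (nat \<Rightarrow> nat) \<Rightarrow> square set" where
  "skew \<alpha> \<beta> = {(i, j). 1 \<le> i \<and> int (\<beta> (nat i)) < j \<and> j \<le> int (\<alpha> (nat i))}"

definition outside_top_corner :: "square set \<Rightarrow> square \<Rightarrow> bool" where
  "outside_top_corner S = (\<lambda>(i, j). (i, j) \<in> S \<and> (i - 1, j) \<notin> S \<and> (i, j - 1) \<notin> S)"

definition inside_top_corner :: "square set \<Rightarrow> square \<Rightarrow> bool" where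
  "inside_top_corner S =
     (\<lambda>(i, j). (i, j) \<in> S \<and> (i - 1, j) \<in> S \<and> (i, j - 1) \<in> S \<and> (i - 1, j - 1) \<notin> S)"

definition diagonal :: "square set \<Rightarrow> square \<Rightarrow> square set" where
  "diagonal S = (\<lambda>(i, j). S \<inter> {(i + p, j + p) | p. 0 \<le> p})"

definition skew_rank :: "(nat \<Rightarrow> nat) \<Rightarrow> (nat \<Rightarrow> nat) \<Rightarrow> int" where
  "skew_rank lam mu = (let S = skew lam mu in
     int (card (\<Union>c \<in> {c. outside_top_corner S c}. diagonal S c))
   - int (card (\<Union>c \<in> {c. inside_top_corner S c}. diagonal S c)))"

section \<open>Border strips, decompositions and tableaux\<close>

definition edge_adjacent :: "square \<Rightarrow> square \<Rightarrow> bool" where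
  "edge_adjacent = (\<lambda>(i, j) (i', j'). \<bar>i - i'\<bar> + \<bar>j - j'\<bar> = 1)"

definition edge_connected :: "square set \<Rightarrow> bool" where
  "edge_connected S \<longleftrightarrow>
     (\<forall>a\<in>S. \<forall>b\<in>S. (a, b) \<in> {(c, d). c \<in> S \<and> d \<in> S \<and> edge_adjacent c d}\<^sup>*)"

definition skew_diagram :: "square set \<Rightarrow> bool" where
  "skew_diagram S \<longleftrightarrow>
     (\<exists>\<alpha> \<beta>. is_partition \<alpha> \<and> is_partition \<beta> \<and> contained \<beta> \<alpha> \<and> S = skew \<alpha> \<beta>)"

definition border_strip :: "square set \<Rightarrow> bool" where
  "border_strip B \<longleftrightarrow> skew_diagram B \<and> B \<noteq> {} \<and> edge_connected B \<and>
     (\<nexists>i j. {(i, j), (i + 1, j), (i, j + 1), (i + 1, j + 1)} \<subseteq> B)"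

definition bs_decomposition :: "(nat \<Rightarrow> nat) \<Rightarrow> (nat \<Rightarrow> nat) \<Rightarrow> square set set \<Rightarrow> bool" where
  "bs_decomposition lam mu D \<longleftrightarrow> partition_on (skew lam mu) D \<and> (\<forall>B\<in>D. border_strip B)"

definition minimal_bs_decomposition ::
    "(nat \<Rightarrow> nat) \<Rightarrow> (nat \<Rightarrow> nat) \<Rightarrow> square set set \<Rightarrow> bool" where
  "minimal_bs_decomposition lam mu D \<longleftrightarrow>
     bs_decomposition lam mu D \<and> (\<forall>D'. bs_decomposition lam mu D' \<longrightarrow> card D \<le> card D')"

text \<open>A tableau is the list of the partitions in its chain, starting at \<open>mu\<close>.\<close>

definition bs_tableau :: "(nat \<Rightarrow> nat) \<Rightarrow> (nat \<Rightarrow> nat) \<Rightarrow> (nat \<Rightarrow> nat) list \<Rightarrow> bool" where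
  "bs_tableau lam mu T \<longleftrightarrow>
     T \<noteq> [] \<and> hd T = mu \<and> last T = lam \<and> (\<forall>\<alpha>\<in>set T. is_partition \<alpha>) \<and>
     (\<forall>i. Suc i < length T \<longrightarrow>
        contained (T ! i) (T ! Suc i) \<and> border_strip (skew (T ! Suc i) (T ! i)))"

definition decomposition_of :: "(nat \<Rightarrow> nat) list \<Rightarrow> square set set" where
  "decomposition_of T = {skew (T ! Suc i) (T ! i) | i. Suc i < length T}"

definition minimal_bs_tableau :: "(nat \<Rightarrow> nat) \<Rightarrow> (nat \<Rightarrow> nat) \<Rightarrow> (nat \<Rightarrow> nat) list \<Rightarrow> bool" where
  "minimal_bs_tableau lam mu T \<longleftrightarrow>
     bs_tableau lam mu T \<and> minimal_bs_decomposition lam mu (decomposition_of T)"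

section \<open>Boundary paths and codes\<close>

text \<open>Steps are given by their starting point: \<open>Hor x y\<close> goes from \<open>(x, y)\<close> to \<open>(x + 1, y)\<close>
  and \<open>Ver x y\<close> goes from \<open>(x, y)\<close> to \<open>(x, y + 1)\<close>.\<close>

datatype step = Hor int int | Ver int int

fun step_index :: "step \<Rightarrow> int" where
  "step_index (Hor x y) = x + y"
| "step_index (Ver x y) = x + y"

definition column_length :: "(nat \<Rightarrow> nat) \<Rightarrow> nat \<Rightarrow> nat" where
  "column_length \<alpha> j = card {i. 1 \<le> i \<and> j \<le> \<alpha> i}"

text \<open>The vertical steps of the path are the right ends of all the rows and its horizontal steps are
  the lower ends of all the columns. Empty rows contribute the initial ray on \<open>x = 0\<close>, empty columns
  the final ray on \<open>y = 0\<close>.\<close>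

definition boundary_path :: "(nat \<Rightarrow> nat) \<Rightarrow> step set" where
  "boundary_path \<alpha> =
     {Ver (int (\<alpha> i)) (- int i) | i. 1 \<le> i} \<union>
     {Hor (int j - 1) (- int (column_length \<alpha> j)) | j. 1 \<le> j}"

definition path_step :: "(nat \<Rightarrow> nat) \<Rightarrow> int \<Rightarrow> step" where
  "path_step \<alpha> k = (THE e. e \<in> boundary_path \<alpha> \<and> step_index e = k)"

definition code :: "(nat \<Rightarrow> nat) \<Rightarrow> int \<Rightarrow> nat" where
  "code \<alpha> k = (case path_step \<alpha> k of Hor x y \<Rightarrow> 1 | Ver x y \<Rightarrow> 0)"

definition step_pair :: "(nat \<Rightarrow> nat) \<Rightarrow> (nat \<Rightarrow> nat) \<Rightarrow> int \<times> int \<Rightarrow> bool" where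
  "step_pair \<alpha> \<beta> = (\<lambda>(u, v). u < v \<and> {k. code \<alpha> k \<noteq> code \<beta> k} = {u, v} \<and>
     code \<alpha> u = 1 \<and> code \<alpha> v = 0)"

definition intervals_of :: "(nat \<Rightarrow> nat) list \<Rightarrow> (int \<times> int) set" where
  "intervals_of T = {p. \<exists>i. Suc i < length T \<and> step_pair (T ! Suc i) (T ! i) p}"

section \<open>Snakes and interval sets\<close>

text \<open>The edge \<open>Hor x y\<close> is the lower edge of the square \<open>(-y, x + 1)\<close>, and \<open>Ver x y\<close> is the right
  edge of the square \<open>(-y, x)\<close>.\<close>

definition snake :: "(nat \<Rightarrow> nat) \<Rightarrow> (nat \<Rightarrow> nat) \<Rightarrow> int \<Rightarrow> square set" where
  "snake lam mu k =
     (if path_step lam k \<in> boundary_path mu then {}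
      else case path_step lam k of
        Hor x y \<Rightarrow> (let i = - y; j = x + 1 in
          skew lam mu \<inter> ({(i - p, j - p) | p. 0 \<le> p} \<union> {(i - p, j - 1 - p) | p. 0 \<le> p}))
      | Ver x y \<Rightarrow> (let i = - y; j = x in
          skew lam mu \<inter> ({(i - p, j - p) | p. 0 \<le> p} \<union> {(i - 1 - p, j - p) | p. 0 \<le> p})))"

definition snake_length :: "(nat \<Rightarrow> nat) \<Rightarrow> (nat \<Rightarrow> nat) \<Rightarrow> int \<Rightarrow> int" where
  "snake_length lam mu k = int (card (snake lam mu k)) - 1"

definition left_snake :: "(nat \<Rightarrow> nat) \<Rightarrow> (nat \<Rightarrow> nat) \<Rightarrow> int \<Rightarrow> bool" where
  "left_snake lam mu k \<longleftrightarrow> (\<exists>x y. path_step lam k = Hor x y) \<and>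
     0 \<le> snake_length lam mu k \<and> even (snake_length lam mu k)"

definition right_snake :: "(nat \<Rightarrow> nat) \<Rightarrow> (nat \<Rightarrow> nat) \<Rightarrow> int \<Rightarrow> bool" where
  "right_snake lam mu k \<longleftrightarrow> (\<exists>x y. path_step lam k = Ver x y) \<and>
     0 \<le> snake_length lam mu k \<and> even (snake_length lam mu k)"

definition interval_set :: "(nat \<Rightarrow> nat) \<Rightarrow> (nat \<Rightarrow> nat) \<Rightarrow> (int \<times> int) set \<Rightarrow> bool" where
  "interval_set lam mu I \<longleftrightarrow>
     finite I \<and> int (card I) = skew_rank lam mu \<and> card (fst ` I \<union> snd ` I) = 2 * card I \<and>
     (\<forall>(u, v)\<in>I. u < v \<and> left_snake lam mu u \<and> right_snake lam mu v)"

definition num_interval_sets :: "(nat \<Rightarrow> nat) \<Rightarrow> (nat \<Rightarrow> nat) \<Rightarrow> nat" where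
  "num_interval_sets lam mu = card {I. interval_set lam mu I}"

definition minimal_tableaux_for ::
    "(nat \<Rightarrow> nat) \<Rightarrow> (nat \<Rightarrow> nat) \<Rightarrow> (int \<times> int) set \<Rightarrow> (nat \<Rightarrow> nat) list set" where
  "minimal_tableaux_for lam mu I = {T. minimal_bs_tableau lam mu T \<and> intervals_of T = I}"

section \<open>The step of a given index is well defined\<close>

lemma partition_antimono:
  assumes "is_partition \<alpha>" "1 \<le> i" "i \<le> i'"
  shows "\<alpha> i' \<le> \<alpha> i"
  using assms(3)
proof (induction i' rule: dec_induct)
  case (step n)
  then have "\<alpha> (Suc n) \<le> \<alpha> n" using assms by (simp add: is_partition_def)
  then show ?case using step by simp
qed simp

lemma column_length_iff:
  assumes \<alpha>: "is_partition \<alpha>" and i: "1 \<le> i" and j: "1 \<le> j"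
  shows "i \<le> column_length \<alpha> j \<longleftrightarrow> j \<le> \<alpha> i"
proof -
  let ?A = "{i. 1 \<le> i \<and> j \<le> \<alpha> i}"
  have fin: "finite ?A"
    by (rule finite_subset[of _ "{i. \<alpha> i \<noteq> 0}"]) (use \<alpha> j in \<open>auto simp: is_partition_def\<close>)
  show ?thesis
  proof
    assume "j \<le> \<alpha> i"
    then have "{1..i} \<subseteq> ?A"
      using partition_antimono[OF \<alpha>, of _ i] by (auto intro: order_trans)
    then have "card {1..i} \<le> card ?A" using fin by (rule card_mono[rotated])
    then show "i \<le> column_length \<alpha> j" by (simp add: column_length_def)
  next
    assume le: "i \<le> column_length \<alpha> j"
    show "j \<le> \<alpha> i"
    proof (rule ccontr)
      assume n: "\<not> j \<le> \<alpha> i"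
      have "?A \<subseteq> {1..<i}"
      proof
        fix m assume m: "m \<in> ?A"
        have "m < i"
        proof (rule ccontr)
          assume "\<not> m < i"
          then have "\<alpha> m \<le> \<alpha> i" using partition_antimono[OF \<alpha> i, of m] by simp
          then show False using m n by simp
        qed
        then show "m \<in> {1..<i}" using m by simp
      qed
      then have "card ?A \<le> card {1..<i}" by (intro card_mono) auto
      then show False using le i by (simp add: column_length_def)
    qed
  qed
qed

lemma path_step_ex1:
  assumes \<alpha>: "is_partition \<alpha>"
  shows "\<exists>!e. e \<in> boundary_path \<alpha> \<and> step_index e = k"
proof (rule ex_ex1I)
  have "finite {i. \<alpha> i \<noteq> 0}" using \<alpha> by (simp add: is_partition_def)
  then obtain N where N: "\<And>i. i > N \<Longrightarrow> \<alpha> i = 0"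
    by (metis (mono_tags, lifting) finite_nat_set_iff_bounded_le mem_Collect_eq not_le)
  let ?P = "\<lambda>i. 1 \<le> i \<and> int (\<alpha> i) - int i \<le> k"
  have "?P (Suc N + nat (- k))" using N[of "Suc N + nat (- k)"] by simp
  define i where "i = (LEAST i. ?P i)"
  have Pi: "?P i" unfolding i_def by (rule LeastI) fact
  have nP: "\<not> ?P m" if "m < i" for m using that not_less_Least unfolding i_def by blast
  show "\<exists>e. e \<in> boundary_path \<alpha> \<and> step_index e = k"
  proof (cases "int (\<alpha> i) - int i = k")
    case True
    then show ?thesis using Pi
      by (intro exI[of _ "Ver (int (\<alpha> i)) (- int i)"]) (auto simp: boundary_path_def)
  next
    case False
    define j where "j = nat (k + int i)"
    have j: "int j = k + int i" "1 \<le> j" "\<alpha> i < j" using Pi False by (auto simp: j_def)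
    have "column_length \<alpha> j < i" using column_length_iff[OF \<alpha>, of i j] Pi j by simp
    moreover have "i - 1 \<le> column_length \<alpha> j"
    proof (cases "i = 1")
      case False
      then have "1 \<le> i - 1" "i - 1 < i" using Pi by auto
      then have "j \<le> \<alpha> (i - 1)" using nP[of "i - 1"] j by (simp add: of_nat_diff)
      then show ?thesis using column_length_iff[OF \<alpha> \<open>1 \<le> i - 1\<close> j(2)] by simp
    qed simp
    ultimately have "int (column_length \<alpha> j) = int i - 1" by linarith
    then have "step_index (Hor (int j - 1) (- int (column_length \<alpha> j))) = k" using j by simp
    moreover have "Hor (int j - 1) (- int (column_length \<alpha> j)) \<in> boundary_path \<alpha>"
      using j(2) unfolding boundary_path_def by blast
    ultimately show ?thesis by blast
  qed
next
  have VV: "i = i'" if "1 \<le> i" "1 \<le> i'" "int (\<alpha> i) - int i = int (\<alpha> i') - int i'" for i i'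
    using that partition_antimono[OF \<alpha>, of i i'] partition_antimono[OF \<alpha>, of i' i]
    by linarith
  have VH: False if "1 \<le> i" "1 \<le> j" "int (\<alpha> i) - int i = int j - 1 - int (column_length \<alpha> j)"
    for i j
    using that column_length_iff[OF \<alpha>, of i j] by linarith
  have HH: "j = j'" if "1 \<le> j" "1 \<le> j'"
      "int j - int (column_length \<alpha> j) = int j' - int (column_length \<alpha> j')" for j j'
  proof -
    have mono: "column_length \<alpha> b \<le> column_length \<alpha> a" if "1 \<le> a" "a \<le> b" for a b
    proof (cases "column_length \<alpha> b = 0")
      case False
      then have "1 \<le> column_length \<alpha> b" by simp
      then show ?thesis
        using column_length_iff[OF \<alpha>, of "column_length \<alpha> b" b]
          column_length_iff[OF \<alpha>, of "column_length \<alpha> b" a] that by simp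
    qed simp
    show ?thesis using that mono[of j j'] mono[of j' j] by linarith
  qed
  have shape: "(\<exists>i\<ge>1. e = Ver (int (\<alpha> i)) (- int i) \<and> int (\<alpha> i) - int i = k) \<or>
      (\<exists>j\<ge>1. e = Hor (int j - 1) (- int (column_length \<alpha> j)) \<and>
         int j - 1 - int (column_length \<alpha> j) = k)"
    if "e \<in> boundary_path \<alpha> \<and> step_index e = k" for e
    using that by (auto simp: boundary_path_def)
  fix e e'
  assume "e \<in> boundary_path \<alpha> \<and> step_index e = k" "e' \<in> boundary_path \<alpha> \<and> step_index e' = k"
  from this[THEN shape] show "e = e'"
  proof (elim disjE exE conjE)
    fix i i' assume *: "1 \<le> i" "1 \<le> i'" "int (\<alpha> i) - int i = k" "int (\<alpha> i') - int i' = k"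
      "e = Ver (int (\<alpha> i)) (- int i)" "e' = Ver (int (\<alpha> i')) (- int i')"
    then show ?thesis using VV[of i i'] by simp
  next
    fix j j' assume *: "1 \<le> j" "1 \<le> j'"
      "int j - 1 - int (column_length \<alpha> j) = k" "int j' - 1 - int (column_length \<alpha> j') = k"
      "e = Hor (int j - 1) (- int (column_length \<alpha> j))"
      "e' = Hor (int j' - 1) (- int (column_length \<alpha> j'))"
    then have "j = j'" by (intro HH) auto
    then show ?thesis using * by simp
  qed (use VH in metis)+
qed

end

theory Submission
  imports Defs "HOL-Combinatorics.Multiset_Permutations"
begin

text \<open>A partition is encoded by its beads \<open>\<alpha>\<^sub>i - i\<close>, the positions of the zeros of its code. Adding a
  border strip moves one bead from some \<open>u\<close> to some free \<open>v > u\<close>, and the length of the snake \<open>S\<^sub>k\<close> is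
  even exactly when the codes of \<open>\<lambda>\<close> and \<open>\<mu>\<close> differ at \<open>k\<close>. So interval sets are the perfect matchings
  \<open>u < v\<close> between the \<open>r\<close> beads lost and the \<open>r\<close> beads gained, and the minimal tableaux of an interval
  set are its \<open>r!\<close> orderings. Two orderings give the same decomposition iff they order every pair of
  overlapping intervals alike. Inserting the intervals by increasing left end \<open>u\<close>, each one meets a
  clique of \<open>k\<close> earlier intervals (those that contain \<open>u\<close>) and can take \<open>k + 1\<close> places among them, and
  \<open>k + 1\<close> depends only on the end points. The product of these numbers also counts the matchings.\<close>

section \<open>Beads of a partition\<close>

text \<open>The working coordinate is the running count of the code:
  \<open>beads_from \<alpha> c\<close>, the number of beads at or beyond \<open>c\<close>, is the
  last row of \<open>\<alpha>\<close> on the diagonal of content \<open>c\<close>. A bead move from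
  \<open>u\<close> to \<open>v\<close> raises it by one exactly for \<open>u < c \<le> v\<close>. So
  a strip takes the next free square on each of these diagonals, and its place depends only on which
  earlier strips meet them; conversely, the depths of two strips on a shared diagonal reveal their
  order. The rank is defined by corners of \<open>\<mu>\<close>, not by beads. Corners are changes
  of the code of \<open>\<mu>\<close>, diagonal sizes change by code differences, and summation by
  parts turns the rank into the number of beads gained. Since the corner weights add up to at most 1
  on a border strip, the rank also bounds the number of strips from below. The obstacle in the count
  is that which intervals overlap depends on the matching. The number of intervals over a left end
  does not: it is a difference of counts of end points beyond it.\<close>

definition beads :: "(nat \<Rightarrow> nat) \<Rightarrow> int set" where
  "beads \<alpha> = (\<lambda>i. int (\<alpha> i) - int i) ` {1..}"

text \<open>For \<open>c < 0\<close> the count includes the rows up to \<open>-c\<close>, where the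
  diagonal runs through columns \<open>\<le> 0\<close>. This makes it a row number for every
  \<open>c\<close>, and these rows cancel in the difference of two partitions.\<close>

definition beads_from :: "(nat \<Rightarrow> nat) \<Rightarrow> int \<Rightarrow> nat" where
  "beads_from \<alpha> c = card {i. 1 \<le> i \<and> c \<le> int (\<alpha> i) - int i}"

definition content :: "square \<Rightarrow> int" where
  "content = (\<lambda>(i, j). j - i)"

lemma content_Pair [simp]: "content (i, j) = j - i"
  by (simp add: content_def)

lemma partition_eventually_zero:
  assumes "is_partition \<alpha>"
  obtains n where "\<And>i. i \<ge> n \<Longrightarrow> \<alpha> i = 0"
proof -
  have "finite {i. \<alpha> i \<noteq> 0}" using assms by (simp add: is_partition_def)
  then obtain n where "\<And>i. \<alpha> i \<noteq> 0 \<Longrightarrow> i < n"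
    by (auto simp: finite_nat_set_iff_bounded)
  then show ?thesis using that[of n] by (meson not_less)
qed

lemma partition_le_first:
  assumes "is_partition \<alpha>"
  shows "\<alpha> i \<le> \<alpha> 1"
  using partition_antimono[OF assms, of 1 i] assms
  by (cases "i = 0") (auto simp: is_partition_def)

lemma beads_decreasing:
  assumes "is_partition \<alpha>" "1 \<le> i" "i < j"
  shows "int (\<alpha> j) - int j < int (\<alpha> i) - int i"
  using partition_antimono[OF assms(1,2), of j] assms(3) by linarith

lemma finite_beads_from:
  assumes "is_partition \<alpha>"
  shows "finite {i. 1 \<le> i \<and> c \<le> int (\<alpha> i) - int i}"
proof (rule finite_subset)
  show "{i. 1 \<le> i \<and> c \<le> int (\<alpha> i) - int i} \<subseteq> {..nat (int (\<alpha> 1) - c)}"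
  proof
    fix i assume "i \<in> {i. 1 \<le> i \<and> c \<le> int (\<alpha> i) - int i}"
    then have "int i \<le> int (\<alpha> 1) - c" using partition_le_first[OF assms, of i] by simp
    then show "i \<in> {..nat (int (\<alpha> 1) - c)}" by simp
  qed
qed simp

text \<open>Since \<open>\<alpha> i - i\<close> strictly decreases, the rows counted form an initial
  segment, so their number is also the largest of them.\<close>

lemma le_beads_from_iff:
  assumes "is_partition \<alpha>" "1 \<le> i"
  shows "i \<le> beads_from \<alpha> c \<longleftrightarrow> c \<le> int (\<alpha> i) - int i"
proof -
  let ?M = "{i. 1 \<le> i \<and> c \<le> int (\<alpha> i) - int i}"
  have fin: "finite ?M" by (rule finite_beads_from[OF assms(1)])
  have down: "k \<in> ?M" if "m \<in> ?M" "1 \<le> k" "k \<le> m" for k m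
    using that beads_decreasing[OF assms(1), of k m] by (cases "k = m") auto
  show ?thesis
  proof
    assume "c \<le> int (\<alpha> i) - int i"
    then have "{1..i} \<subseteq> ?M" using down[of i] assms(2) by auto
    from card_mono[OF fin this] show "i \<le> beads_from \<alpha> c" by (simp add: beads_from_def)
  next
    assume le: "i \<le> beads_from \<alpha> c"
    show "c \<le> int (\<alpha> i) - int i"
    proof (rule ccontr)
      assume n: "\<not> c \<le> int (\<alpha> i) - int i"
      have "?M \<subseteq> {1..<i}"
      proof
        fix m assume m: "m \<in> ?M"
        then have "\<not> i \<le> m" using down[OF m assms(2)] n by auto
        then show "m \<in> {1..<i}" using m by simp
      qed
      then have "card ?M \<le> card {1..<i}" by (intro card_mono) auto
      then show False using le assms(2) by (simp add: beads_from_def)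
    qed
  qed
qed

lemma inj_on_beads:
  assumes "is_partition \<alpha>"
  shows "inj_on (\<lambda>i. int (\<alpha> i) - int i) {1..}"
proof (rule inj_onI)
  fix i j assume "i \<in> {1..}" "j \<in> {1..}" "int (\<alpha> i) - int i = int (\<alpha> j) - int j"
  then show "i = j"
    using beads_decreasing[OF assms, of i j] beads_decreasing[OF assms, of j i]
    by (cases i j rule: linorder_cases) auto
qed

lemma beads_from_eq_image:
  "{z \<in> beads \<alpha>. c \<le> z} = (\<lambda>i. int (\<alpha> i) - int i) ` {i. 1 \<le> i \<and> c \<le> int (\<alpha> i) - int i}"
  by (auto simp: beads_def)

lemma finite_beads_above:
  assumes "is_partition \<alpha>"
  shows "finite {z \<in> beads \<alpha>. c \<le> z}"
  unfolding beads_from_eq_image using finite_beads_from[OF assms] by simp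

lemma beads_from_eq_card:
  assumes "is_partition \<alpha>"
  shows "beads_from \<alpha> c = card {z \<in> beads \<alpha>. c \<le> z}"
proof -
  have "inj_on (\<lambda>i. int (\<alpha> i) - int i) {i. 1 \<le> i \<and> c \<le> int (\<alpha> i) - int i}"
    by (rule inj_on_subset[OF inj_on_beads[OF assms]]) auto
  then show ?thesis unfolding beads_from_eq_image beads_from_def by (simp add: card_image)
qed

text \<open>The code is the discrete derivative of the diagonal counts; this is the bridge between
  squares and code entries in both directions.\<close>

lemma beads_from_step:
  assumes "is_partition \<alpha>"
  shows "beads_from \<alpha> c = beads_from \<alpha> (c + 1) + (if c \<in> beads \<alpha> then 1 else 0)"
proof -
  have "{z \<in> beads \<alpha>. c \<le> z} = {z \<in> beads \<alpha>. c + 1 \<le> z} \<union> (if c \<in> beads \<alpha> then {c} else {})"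
    by (auto simp: order_le_less)
  then show ?thesis
    using finite_beads_above[OF assms, of "c + 1"]
    by (simp add: beads_from_eq_card[OF assms] card_Un_disjoint split: if_splits)
qed

lemma contained_if_beads_from_le:
  assumes "is_partition \<alpha>" "is_partition \<beta>" "\<And>c. beads_from \<beta> c \<le> beads_from \<alpha> c"
  shows "contained \<beta> \<alpha>"
  unfolding contained_def
proof
  fix i
  show "\<beta> i \<le> \<alpha> i"
  proof (cases "i = 0")
    case False
    \<comment> \<open>The comparison is tested at the bead of row \<open>i\<close> of
      \<open>\<beta>\<close> itself.\<close>
    then have "i \<le> beads_from \<beta> (int (\<beta> i) - int i)" using le_beads_from_iff[OF assms(2)] by simp
    then have "i \<le> beads_from \<alpha> (int (\<beta> i) - int i)" using assms(3) le_trans by blast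
    then show ?thesis using le_beads_from_iff[OF assms(1)] False by simp
  qed (use assms in \<open>simp add: is_partition_def\<close>)
qed

lemma beads_from_mono:
  assumes "is_partition \<alpha>" "contained \<beta> \<alpha>"
  shows "beads_from \<beta> c \<le> beads_from \<alpha> c"
  unfolding beads_from_def
proof (rule card_mono[OF finite_beads_from[OF assms(1)]], rule subsetI)
  fix i assume "i \<in> {i. 1 \<le> i \<and> c \<le> int (\<beta> i) - int i}"
  moreover have "\<beta> i \<le> \<alpha> i" using assms(2) by (simp add: contained_def)
  ultimately show "i \<in> {i. 1 \<le> i \<and> c \<le> int (\<alpha> i) - int i}" by simp
qed

lemma inj_on_beads_partition: "inj_on beads {\<alpha>. is_partition \<alpha>}"
proof (rule inj_onI)
  fix \<alpha> \<beta> assume *: "\<alpha> \<in> {\<alpha>. is_partition \<alpha>}" "\<beta> \<in> {\<alpha>. is_partition \<alpha>}" "beads \<alpha> = beads \<beta>"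
  then have "beads_from \<alpha> c = beads_from \<beta> c" for c by (simp add: beads_from_eq_card)
  then have "contained \<alpha> \<beta>" "contained \<beta> \<alpha>" using * by (auto intro: contained_if_beads_from_le)
  then show "\<alpha> = \<beta>" by (auto simp: contained_def intro!: ext le_antisym)
qed

text \<open>A square lies in \<open>\<alpha>\<close> iff its content is at most the bead of its row.
  Hence each diagonal meets the skew diagram in one run of consecutive rows, and questions about
  squares become inequalities between counts.\<close>

lemma mem_skew_iff:
  assumes "is_partition \<alpha>" "is_partition \<beta>"
  shows "(i, j) \<in> skew \<alpha> \<beta> \<longleftrightarrow>
    int (beads_from \<beta> (j - i)) < i \<and> i \<le> int (beads_from \<alpha> (j - i))"
proof (cases "1 \<le> i")
  case True
  then show ?thesis
    using le_beads_from_iff[OF assms(1), of "nat i" "j - i"]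
      le_beads_from_iff[OF assms(2), of "nat i" "j - i"]
    by (simp add: skew_def not_le[symmetric]) linarith
qed (auto simp: skew_def)

lemma finite_skew:
  assumes "is_partition \<alpha>"
  shows "finite (skew \<alpha> \<beta>)"
proof -
  obtain n where n: "\<And>i. i \<ge> n \<Longrightarrow> \<alpha> i = 0" using partition_eventually_zero[OF assms] by blast
  have "skew \<alpha> \<beta> \<subseteq> {0..int n} \<times> {0..int (\<alpha> 1)}"
  proof (rule subsetI)
    fix s assume "s \<in> skew \<alpha> \<beta>"
    then obtain i j where s: "s = (i, j)" "1 \<le> i" "int (\<beta> (nat i)) < j" "j \<le> int (\<alpha> (nat i))"
      by (auto simp: skew_def)
    then have "\<not> n \<le> nat i" using n[of "nat i"] by auto
    then show "s \<in> {0..int n} \<times> {0..int (\<alpha> 1)}"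
      using s partition_le_first[OF assms, of "nat i"] by auto
  qed
  then show ?thesis by (rule finite_subset) simp
qed

lemma card_skew_diagonal:
  assumes "is_partition \<alpha>" "is_partition \<beta>"
  shows "card {s \<in> skew \<alpha> \<beta>. content s = c} = beads_from \<alpha> c - beads_from \<beta> c"
proof -
  have "{s \<in> skew \<alpha> \<beta>. content s = c} =
      (\<lambda>i. (i, i + c)) ` {int (beads_from \<beta> c) <.. int (beads_from \<alpha> c)}"
    by (auto simp: mem_skew_iff[OF assms] image_iff)
  moreover have "inj_on (\<lambda>i. (i, i + c)) {int (beads_from \<beta> c) <.. int (beads_from \<alpha> c)}"
    by (rule inj_onI) simp
  ultimately show ?thesis by (simp add: card_image)
qed

text \<open>The upper left square controls the inner boundary and the lower right square the outer
  one.\<close>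

lemma skew_convex:
  assumes "is_partition \<alpha>" "is_partition \<beta>" "(i, j) \<in> skew \<alpha> \<beta>" "(i', j') \<in> skew \<alpha> \<beta>"
    and "i \<le> k" "k \<le> i'" "j \<le> l" "l \<le> j'"
  shows "(k, l) \<in> skew \<alpha> \<beta>"
proof -
  have "1 \<le> i" using assms(3) by (simp add: skew_def)
  then have "\<beta> (nat k) \<le> \<beta> (nat i)" "\<alpha> (nat i') \<le> \<alpha> (nat k)"
    using assms partition_antimono[OF assms(2), of "nat i" "nat k"]
      partition_antimono[OF assms(1), of "nat k" "nat i'"] by auto
  then show ?thesis using assms \<open>1 \<le> i\<close> by (simp add: skew_def)
qed

text \<open>The path ends at height 0 and climbs exactly at the beads, so step \<open>k\<close>
  starts at height minus the number of beads from \<open>k\<close> on; its index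
  \<open>x + y = k\<close> then gives \<open>x\<close>.\<close>

lemma path_step_eq:
  assumes \<alpha>: "is_partition \<alpha>"
  shows "path_step \<alpha> k = (let m = int (beads_from \<alpha> k) in
    if k \<in> beads \<alpha> then Ver (k + m) (- m) else Hor (k + m) (- m))"
proof -
  have mem: "path_step \<alpha> k \<in> boundary_path \<alpha>" and ind: "step_index (path_step \<alpha> k) = k"
    using theI'[OF path_step_ex1[OF \<alpha>, of k]] by (auto simp: path_step_def)
  have VV: "k \<in> beads \<alpha> \<and> beads_from \<alpha> k = i" if "1 \<le> i" "int (\<alpha> i) - int i = k" for i
  proof
    show "k \<in> beads \<alpha>" using that by (auto simp: beads_def)
    have "i \<le> beads_from \<alpha> k" "\<not> Suc i \<le> beads_from \<alpha> k"
      using le_beads_from_iff[OF \<alpha>, of i k] le_beads_from_iff[OF \<alpha>, of "Suc i" k]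
        beads_decreasing[OF \<alpha>, of i "Suc i"] that by auto
    then show "beads_from \<alpha> k = i" by simp
  qed
  from mem consider (V) i where "1 \<le> i" "path_step \<alpha> k = Ver (int (\<alpha> i)) (- int i)"
    | (H) j where "1 \<le> j" "path_step \<alpha> k = Hor (int j - 1) (- int (column_length \<alpha> j))"
    by (auto simp: boundary_path_def)
  then show ?thesis
  proof cases
    case V
    then have "int (\<alpha> i) - int i = k" using ind by simp
    with VV[OF V(1) this] V show ?thesis by (simp add: Let_def)
  next
    case H
    let ?m = "column_length \<alpha> j"
    have k: "int j - 1 - int ?m = k" using ind H by simp
    have up: "\<not> Suc ?m \<le> beads_from \<alpha> k"
      using le_beads_from_iff[OF \<alpha>, of "Suc ?m" k] column_length_iff[OF \<alpha>, of "Suc ?m" j] H k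
      by simp
    have low: "?m \<le> beads_from \<alpha> (k + 1)"
    proof (cases "?m = 0")
      case False
      then show ?thesis
        using le_beads_from_iff[OF \<alpha>, of ?m "k + 1"] column_length_iff[OF \<alpha>, of ?m j] H k
        by simp
    qed simp
    \<comment> \<open>The count is at most \<open>?m\<close> at \<open>k\<close> and at least
      \<open>?m\<close> at \<open>k + 1\<close>, and it cannot increase, so it is constant there and
      \<open>k\<close> carries no bead.\<close>
    from up low beads_from_step[OF \<alpha>, of k] have "k \<notin> beads \<alpha>" "beads_from \<alpha> k = ?m"
      by (auto split: if_splits)
    then show ?thesis using H k by (simp add: Let_def)
  qed
qed

lemma code_eq: "is_partition \<alpha> \<Longrightarrow> code \<alpha> k = (if k \<in> beads \<alpha> then 0 else 1)"
  by (simp add: code_def path_step_eq Let_def)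

lemma path_step_in_boundary_path_iff:
  assumes "is_partition \<alpha>" "is_partition \<beta>"
  shows "path_step \<alpha> k \<in> boundary_path \<beta> \<longleftrightarrow> path_step \<alpha> k = path_step \<beta> k"
proof -
  have "step_index (path_step \<alpha> k) = k" using path_step_eq[OF assms(1), of k]
    by (auto simp: Let_def)
  then show ?thesis
    using theI'[OF path_step_ex1[OF assms(2), of k]] path_step_ex1[OF assms(2), of k]
    by (auto simp: path_step_def)
qed

section \<open>Border strips as bead moves\<close>

lemma bead_move_exists:
  assumes \<beta>: "is_partition \<beta>" and u: "u \<in> beads \<beta>" and v: "v \<notin> beads \<beta>" and uv: "u < v"
  shows "\<exists>\<alpha>. is_partition \<alpha> \<and> beads \<alpha> = insert v (beads \<beta> - {u})"
proof -
  define z where "z = (\<lambda>i. int (\<beta> i) - int i)"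
  have dec: "z j < z i" if "1 \<le> i" "i < j" for i j
    using beads_decreasing[OF \<beta> that] by (simp add: z_def)
  obtain l where l: "1 \<le> l" "z l = u" using u by (auto simp: beads_def z_def)
  define k where "k = (LEAST i. 1 \<le> i \<and> z i < v)"
  have k: "1 \<le> k" "z k < v" using LeastI[of "\<lambda>i. 1 \<le> i \<and> z i < v" l] l uv by (auto simp: k_def)
  have kl: "k \<le> l" unfolding k_def using l uv by (intro Least_le) simp
  have less: "v < z i" if "1 \<le> i" "i < k" for i
  proof -
    have "\<not> z i < v" using not_less_Least[of i "\<lambda>i. 1 \<le> i \<and> z i < v"] that unfolding k_def by blast
    moreover have "z i \<noteq> v" using v that(1) by (auto simp: beads_def z_def)
    ultimately show ?thesis by simp
  qed
  \<comment> \<open>The bead sequence sorted anew: \<open>v\<close> enters at row \<open>k\<close>,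
    the first row whose bead is below \<open>v\<close>, and the beads of rows \<open>k\<close> to
    \<open>l - 1\<close> slide down one row, over the place that \<open>u\<close> leaves in row
    \<open>l\<close>.\<close>
  define y where "y = (\<lambda>i. if i = k then v else if k < i \<and> i \<le> l then z (i - 1) else z i)"
  have ydec: "y (Suc i) < y i" if "1 \<le> i" for i
  proof -
    consider "Suc i < k" | "Suc i = k" | "i = k" "i < l" | "i = k" "i = l" | "k < i" "i < l"
      | "k < i" "i = l" | "l < i"
      using kl by linarith
    then show ?thesis
    proof cases
      case 4
      then show ?thesis using dec[of l "Suc l"] l uv by (simp add: y_def)
    next
      case 6
      then show ?thesis using dec[of "l - 1" "Suc l"] k by (simp add: y_def)
    next
      case 5
      then show ?thesis using dec[of "i - 1" i] k by (simp add: y_def)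
    qed (use dec[of i "Suc i"] that less[of i] k kl in \<open>auto simp: y_def\<close>)
  qed
  define \<alpha> where "\<alpha> = (\<lambda>i. nat (y i + int i))"
  \<comment> \<open>Guards the \<open>nat\<close> in \<open>\<alpha>\<close> against truncation: in
    row \<open>k\<close> the new part exceeds \<open>\<beta> k\<close>, and a row that receives the
    bead above it gets the part \<open>\<beta> (i - 1) + 1\<close>.\<close>
  have nonneg: "0 \<le> y i + int i" for i
    using k by (auto simp: y_def z_def)
  then have y_eq: "int (\<alpha> i) - int i = y i" for i by (simp add: \<alpha>_def)
  have "is_partition \<alpha>"
    unfolding is_partition_def
  proof (intro conjI allI impI)
    show "\<alpha> 0 = 0" using k \<beta> by (simp add: \<alpha>_def y_def z_def is_partition_def)
    show "\<alpha> (Suc i) \<le> \<alpha> i" if "1 \<le> i" for i using ydec[OF that] by (simp add: \<alpha>_def)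
    have "{i. \<alpha> i \<noteq> 0} \<subseteq> {..l} \<union> {i. \<beta> i \<noteq> 0}" using kl by (auto simp: \<alpha>_def y_def z_def)
    then show "finite {i. \<alpha> i \<noteq> 0}"
      using \<beta> by (auto simp: is_partition_def intro: finite_subset)
  qed
  moreover have "beads \<alpha> = insert v (beads \<beta> - {u})"
  proof -
    have inj: "inj_on z {1..}" using inj_on_beads[OF \<beta>] by (simp add: z_def)
    have zim: "beads \<beta> = z ` {1..}" by (simp add: beads_def z_def)
    have "beads \<alpha> = y ` {1..}" by (simp add: beads_def y_eq)
    also have "{1..} = {1..<k} \<union> {k} \<union> {k<..l} \<union> {l<..}" using k(1) kl by auto
    also have "y ` \<dots> = y ` {1..<k} \<union> {v} \<union> y ` {k<..l} \<union> y ` {l<..}"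
      by (simp only: image_Un) (simp add: y_def)
    also have "y ` {1..<k} = z ` {1..<k}" by (intro image_cong) (auto simp: y_def)
    also have "y ` {l<..} = z ` {l<..}" using kl by (intro image_cong) (auto simp: y_def)
    also have "y ` {k<..l} = z ` {k..<l}"
    proof -
      have "{k<..l} = Suc ` {k..<l}" unfolding image_Suc_atLeastLessThan by auto
      then have "y ` {k<..l} = (\<lambda>i. y (Suc i)) ` {k..<l}" by (simp only: image_image)
      also have "\<dots> = z ` {k..<l}" by (intro image_cong) (simp_all add: y_def)
      finally show ?thesis .
    qed
    also have "z ` {1..<k} \<union> {v} \<union> z ` {k..<l} \<union> z ` {l<..} =
        insert v (z ` ({1..<k} \<union> {k..<l} \<union> {l<..}))" by (auto simp: image_Un)
    also have "{1..<k} \<union> {k..<l} \<union> {l<..} = {1..} - {l}" using k(1) kl by auto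
    also have "z ` ({1..} - {l}) = beads \<beta> - {u}"
      using inj l zim by (simp add: inj_on_image_set_diff)
    finally show ?thesis .
  qed
  ultimately show ?thesis by blast
qed

text \<open>The count from \<open>c\<close> on notices the move only if \<open>c\<close> separates
  the old site from the new one. Hence the strip has one square on each diagonal from
  \<open>u + 1\<close> to \<open>v\<close>.\<close>

lemma beads_from_bead_move:
  assumes "is_partition \<alpha>" "is_partition \<beta>" "beads \<alpha> = insert v (beads \<beta> - {u})"
    and "u \<in> beads \<beta>" "v \<notin> beads \<beta>" "u < v"
  shows "beads_from \<alpha> c = beads_from \<beta> c + (if u < c \<and> c \<le> v then 1 else 0)"
proof -
  let ?S = "{z \<in> beads \<beta>. c \<le> z}"
  have fin: "finite ?S" using assms(2) by (rule finite_beads_above)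
  have eq: "{z \<in> beads \<alpha>. c \<le> z} = (if c \<le> v then insert v (?S - {u}) else ?S - {u})"
    unfolding assms(3) by auto
  consider "c \<le> u" | "u < c" "c \<le> v" | "v < c" by linarith
  then show ?thesis
  proof cases
    case 1
    then have "u \<in> ?S" using assms by simp
    then have "card ?S = Suc (card (?S - {u}))" by (rule card.remove[OF fin])
    then show ?thesis
      using 1 assms fin eq by (simp add: beads_from_eq_card)
  next
    case 2
    then have "?S - {u} = ?S" by auto
    then show ?thesis using 2 assms fin eq by (simp add: beads_from_eq_card)
  next
    case 3
    then have "?S - {u} = ?S" using assms by auto
    then show ?thesis using 3 assms fin eq by (simp add: beads_from_eq_card)
  qed
qed

text \<open>A discrete intermediate value theorem: crossing an edge changes the content by
  one.\<close>

lemma connected_intermediate_content: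
  assumes "(s, t) \<in> {(c, d). c \<in> S \<and> d \<in> S \<and> edge_adjacent c d}\<^sup>*"
    and "s \<in> S" "content s \<le> c" "c \<le> content t"
  shows "\<exists>w\<in>S. content w = c"
  using assms
proof (induction rule: rtrancl_induct)
  case base
  then show ?case by (metis order_antisym)
next
  case (step t t')
  show ?case
  proof (cases "c \<le> content t")
    case False
    have "content t' \<le> content t + 1" "t' \<in> S"
      using step.hyps(2) by (auto simp: edge_adjacent_def content_def split: prod.splits)
    then show ?thesis using False step.prems by (intro bexI[of _ t']) auto
  qed (use step in blast)
qed

text \<open>Two squares on one diagonal would, by convexity, span a forbidden block, so contents are
  distinct; connectedness leaves no gap between them.\<close>

lemma border_stripE:
  assumes "border_strip B"
  obtains a b where "a \<le> b" "bij_betw content B {a..b}"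
proof -
  obtain \<alpha> \<beta> where ab: "is_partition \<alpha>" "is_partition \<beta>" "B = skew \<alpha> \<beta>"
    using assms by (auto simp: border_strip_def skew_diagram_def)
  have fin: "finite B" using finite_skew ab by simp
  have ne: "B \<noteq> {}" and conn: "edge_connected B"
    and no_block: "\<nexists>i j. {(i, j), (i + 1, j), (i, j + 1), (i + 1, j + 1)} \<subseteq> B"
    using assms by (auto simp: border_strip_def)
  have no_later: False if s: "(i, j) \<in> B" "(i', j') \<in> B" "i < i'" "j' - i' = j - i" for i j i' j'
  proof -
    have "(k, l) \<in> B" if "i \<le> k" "k \<le> i'" "j \<le> l" "l \<le> j'" for k l
      using skew_convex[OF ab(1,2) s(1,2)[unfolded ab(3)] that] ab(3) by simp
    then have "{(i, j), (i + 1, j), (i, j + 1), (i + 1, j + 1)} \<subseteq> B" using s(3,4) by simp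
    then show False using no_block by blast
  qed
  have "inj_on content B"
  proof (rule inj_onI)
    fix s t assume "s \<in> B" "t \<in> B" "content s = content t"
    then show "s = t"
      using no_later[of "fst s" "snd s" "fst t" "snd t"]
        no_later[of "fst t" "snd t" "fst s" "snd s"]
      by (cases s; cases t; cases "fst s" "fst t" rule: linorder_cases) auto
  qed
  moreover have "content ` B = {Min (content ` B)..Max (content ` B)}"
  proof (intro equalityI subsetI)
    fix c assume c: "c \<in> {Min (content ` B)..Max (content ` B)}"
    have "Min (content ` B) \<in> content ` B" "Max (content ` B) \<in> content ` B" using fin ne by auto
    then obtain s t where s: "s \<in> B" "content s = Min (content ` B)"
      and t: "t \<in> B" "content t = Max (content ` B)"
      by (metis imageE)
    have "(s, t) \<in> {(c, d). c \<in> B \<and> d \<in> B \<and> edge_adjacent c d}\<^sup>*"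
      using conn s(1) t(1) unfolding edge_connected_def by blast
    from connected_intermediate_content[OF this s(1), of c] show "c \<in> content ` B"
      using s(2) t(2) c by auto
  qed (use fin in auto)
  moreover have "Min (content ` B) \<le> Max (content ` B)" using fin ne by simp
  ultimately show ?thesis using that by (simp add: bij_betw_def)
qed

lemma border_strip_skewI:
  assumes \<alpha>: "is_partition \<alpha>" and \<beta>: "is_partition \<beta>" and cont: "contained \<beta> \<alpha>"
    and "a \<le> b" and bij: "bij_betw content (skew \<alpha> \<beta>) {a..b}"
  shows "border_strip (skew \<alpha> \<beta>)"
proof -
  let ?B = "skew \<alpha> \<beta>" and ?E = "{(c, d). c \<in> skew \<alpha> \<beta> \<and> d \<in> skew \<alpha> \<beta> \<and> edge_adjacent c d}"
  have inj: "inj_on content ?B" and img: "content ` ?B = {a..b}" using bij by (auto simp: bij_betw_def)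
  \<comment> \<open>Convexity puts the right or the upper neighbour of \<open>s\<close> into the
    diagram. It has the content of \<open>t\<close>, so by injectivity it is
    \<open>t\<close>.\<close>
  have adj: "edge_adjacent s t" if st: "s \<in> ?B" "t \<in> ?B" "content t = content s + 1" for s t
  proof -
    obtain i j i' j' where s: "s = (i, j)" "t = (i', j')" by (metis prod.exhaust)
    have c: "j' - i' = j - i + 1" using st s by simp
    show ?thesis
    proof (cases "i \<le> i'")
      case True
      then have "(i, j + 1) \<in> ?B" using skew_convex[OF \<alpha> \<beta>, of i j i' j' i "j + 1"] st s c by simp
      then have "(i, j + 1) = t" using st s c by (intro inj_onD[OF inj]) simp_all
      then show ?thesis using s by (auto simp: edge_adjacent_def)
    next
      case False
      then have "(i - 1, j) \<in> ?B" using skew_convex[OF \<alpha> \<beta>, of i' j' i j "i - 1" j] st s c by simp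
      then have "(i - 1, j) = t" using st s c by (intro inj_onD[OF inj]) simp_all
      then show ?thesis using s by (auto simp: edge_adjacent_def)
    qed
  qed
  have up: "(s, t) \<in> ?E\<^sup>*" if "s \<in> ?B" "t \<in> ?B" "content t = content s + int n" for s t n
    using that
  proof (induction n arbitrary: t)
    case 0
    then have "s = t" by (intro inj_onD[OF inj]) simp_all
    then show ?case by simp
  next
    case (Suc n)
    have "content s \<in> {a..b}" "content t \<in> {a..b}" using Suc.prems img by blast+
    then have "content t - 1 \<in> content ` ?B" using Suc.prems(3) img by simp
    then obtain w where w: "w \<in> ?B" "content w = content t - 1" by auto
    then have "(s, w) \<in> ?E\<^sup>*" using Suc by simp
    moreover have "(w, t) \<in> ?E" using adj[of w t] w Suc.prems by simp
    ultimately show ?case by (rule rtrancl_into_rtrancl)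
  qed
  have "sym ?E" by (auto simp: sym_def edge_adjacent_def)
  then have symE: "sym (?E\<^sup>*)" by (rule sym_rtrancl)
  have "edge_connected ?B"
    unfolding edge_connected_def
  proof (intro ballI)
    fix s t assume st: "s \<in> ?B" "t \<in> ?B"
    show "(s, t) \<in> ?E\<^sup>*"
    proof (cases "content s \<le> content t")
      case True
      then show ?thesis using up[OF st, of "nat (content t - content s)"] by simp
    next
      case False
      then have "(t, s) \<in> ?E\<^sup>*" using up[OF st(2,1), of "nat (content s - content t)"] by simp
      then show ?thesis by (rule symD[OF symE])
    qed
  qed
  moreover have "\<nexists>i j. {(i, j), (i + 1, j), (i, j + 1), (i + 1, j + 1)} \<subseteq> ?B"
  proof
    assume "\<exists>i j. {(i, j), (i + 1, j), (i, j + 1), (i + 1, j + 1)} \<subseteq> ?B"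
    then obtain i j where "(i, j) \<in> ?B" "(i + 1, j + 1) \<in> ?B" by auto
    then show False using inj_onD[OF inj, of "(i, j)" "(i + 1, j + 1)"] by simp
  qed
  moreover have "?B \<noteq> {}" using img \<open>a \<le> b\<close> by auto
  ultimately show ?thesis using \<alpha> \<beta> cont by (auto simp: border_strip_def skew_diagram_def)
qed

text \<open>The bead moves from the code position at the lower left end of the strip to the one at its upper
  right end.\<close>

lemma border_strip_skew_iff:
  assumes \<alpha>: "is_partition \<alpha>" and \<beta>: "is_partition \<beta>"
  shows "contained \<beta> \<alpha> \<and> border_strip (skew \<alpha> \<beta>) \<longleftrightarrow>
    (\<exists>u v. u < v \<and> u \<in> beads \<beta> \<and> v \<notin> beads \<beta> \<and> beads \<alpha> = insert v (beads \<beta> - {u}))"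
    (is "?lhs \<longleftrightarrow> ?rhs")
proof
  assume ?lhs
  then obtain a b where ab: "a \<le> b" "bij_betw content (skew \<alpha> \<beta>) {a..b}"
    using border_stripE by blast
  have le: "beads_from \<beta> c \<le> beads_from \<alpha> c" for c using beads_from_mono[OF \<alpha>] \<open>?lhs\<close> by simp
  have d: "beads_from \<alpha> c - beads_from \<beta> c = (if a \<le> c \<and> c \<le> b then 1 else 0)" for c
  proof -
    have inj: "inj_on content (skew \<alpha> \<beta>)" and img: "content ` skew \<alpha> \<beta> = {a..b}"
      using ab by (auto simp: bij_betw_def)
    have "card {s \<in> skew \<alpha> \<beta>. content s = c} = card (content ` {s \<in> skew \<alpha> \<beta>. content s = c})"
      using inj by (intro card_image[symmetric] inj_on_subset[OF inj]) auto
    also have "content ` {s \<in> skew \<alpha> \<beta>. content s = c} = (if c \<in> {a..b} then {c} else {})"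
      unfolding img[symmetric] by force
    finally show ?thesis by (simp add: card_skew_diagonal[OF \<alpha> \<beta>])
  qed
  have eq: "beads_from \<alpha> c = beads_from \<beta> c + (if a \<le> c \<and> c \<le> b then 1 else 0)" for c
    using le[of c] d[of c] by simp
  \<comment> \<open>The difference of the counts is the indicator of \<open>{a..b}\<close>; its
    discrete derivative is supported at the two ends, where a bead appears at \<open>b\<close> and
    one disappears at \<open>a - 1\<close>.\<close>
  have diff: "(if c \<in> beads \<alpha> then 1 else 0 :: int) = (if c \<in> beads \<beta> then 1 else 0) +
      (if c = b then 1 else 0) - (if c = a - 1 then 1 else 0)" for c
  proof -
    have int_eq: "int (beads_from \<alpha> c) = int (beads_from \<beta> c) + (if a \<le> c \<and> c \<le> b then 1 else 0)" for c
      using eq[of c] by simp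
    have step: "(if c \<in> beads \<gamma> then 1 else 0) = int (beads_from \<gamma> c) - int (beads_from \<gamma> (c + 1))"
      if "is_partition \<gamma>" for \<gamma>
      using beads_from_step[OF that, of c] by simp
    show ?thesis
      unfolding step[OF \<alpha>] step[OF \<beta>] int_eq using ab(1) by auto
  qed
  have "a - 1 \<in> beads \<beta>" "b \<notin> beads \<beta>"
    using diff[of "a - 1"] diff[of b] ab(1) by (auto split: if_splits)
  moreover have "beads \<alpha> = insert b (beads \<beta> - {a - 1})"
  proof (rule set_eqI)
    fix c
    show "c \<in> beads \<alpha> \<longleftrightarrow> c \<in> insert b (beads \<beta> - {a - 1})"
      using diff[of c] ab(1) by (auto split: if_splits)
  qed
  ultimately show ?rhs using ab(1) by (intro exI[of _ "a - 1"] exI[of _ b]) simp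
next
  assume ?rhs
  then obtain u v where uv: "u < v" "u \<in> beads \<beta>" "v \<notin> beads \<beta>" "beads \<alpha> = insert v (beads \<beta> - {u})"
    by blast
  have eq: "beads_from \<alpha> c = beads_from \<beta> c + (if u < c \<and> c \<le> v then 1 else 0)" for c
    using beads_from_bead_move[OF \<alpha> \<beta>] uv by simp
  have cont: "contained \<beta> \<alpha>" using eq by (intro contained_if_beads_from_le[OF \<alpha> \<beta>]) simp
  have mem: "(i, j) \<in> skew \<alpha> \<beta> \<longleftrightarrow> u < j - i \<and> j - i \<le> v \<and> i = int (beads_from \<beta> (j - i)) + 1" for i j
    using eq[of "j - i"] by (auto simp: mem_skew_iff[OF \<alpha> \<beta>])
  have "bij_betw content (skew \<alpha> \<beta>) {u + 1..v}"
    unfolding bij_betw_def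
  proof
    show "inj_on content (skew \<alpha> \<beta>)"
    proof (rule inj_onI)
      fix s t assume "s \<in> skew \<alpha> \<beta>" "t \<in> skew \<alpha> \<beta>" "content s = content t"
      then show "s = t" by (cases s; cases t) (simp add: mem)
    qed
    show "content ` skew \<alpha> \<beta> = {u + 1..v}"
    proof (intro equalityI subsetI)
      fix c assume "c \<in> {u + 1..v}"
      then have "(int (beads_from \<beta> c) + 1, int (beads_from \<beta> c) + 1 + c) \<in> skew \<alpha> \<beta>" by (simp add: mem)
      then show "c \<in> content ` skew \<alpha> \<beta>" by (rule rev_image_eqI) simp
    next
      fix c assume "c \<in> content ` skew \<alpha> \<beta>"
      then obtain i j where "(i, j) \<in> skew \<alpha> \<beta>" "c = j - i" by auto
      then show "c \<in> {u + 1..v}" using mem[of i j] by simp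
    qed
  qed
  then show ?lhs using border_strip_skewI[OF \<alpha> \<beta> cont, of "u + 1" v] uv(1) cont by simp
qed

section \<open>Orderings of overlapping intervals and matchings\<close>

text \<open>The strip of an interval has the contents in \<open>{fst p<..snd p}\<close>; for
  intervals with \<open>fst p < snd p\<close> the relation says that the two strips share a
  diagonal.\<close>

definition overlap :: "int \<times> int \<Rightarrow> int \<times> int \<Rightarrow> bool" where
  "overlap p q \<longleftrightarrow> fst p < snd q \<and> fst q < snd p"

text \<open>For a list without repetitions and a symmetric \<open>R\<close>, this is the acyclic
  orientation that the list order gives to the graph of \<open>R\<close>. The orderings with a given
  value are its linear extensions.\<close>

fun precedence :: "('a \<Rightarrow> 'a \<Rightarrow> bool) \<Rightarrow> 'a list \<Rightarrow> ('a \<times> 'a) set" where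
  "precedence R [] = {}"
| "precedence R (x # xs) = {(x, y) | y. y \<in> set xs \<and> R x y} \<union> precedence R xs"

lemma precedence_append:
  "precedence R (xs @ ys) =
    precedence R xs \<union> precedence R ys \<union> {(x, y). x \<in> set xs \<and> y \<in> set ys \<and> R x y}"
  by (induction xs) auto

lemma precedence_subset: "precedence R xs \<subseteq> {(x, y). x \<in> set xs \<and> y \<in> set xs \<and> R x y}"
  by (induction xs) auto

lemma nth_mem_precedence:
  "i < j \<Longrightarrow> j < length xs \<Longrightarrow> R (xs ! i) (xs ! j) \<Longrightarrow> (xs ! i, xs ! j) \<in> precedence R xs"
proof (induction xs arbitrary: i j)
  case (Cons x xs)
  then show ?case by (cases i; cases j) auto
qed simp

lemma precedence_nthE:
  assumes "(x, y) \<in> precedence R xs"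
  obtains i j where "i < j" "j < length xs" "x = xs ! i" "y = xs ! j" "R x y"
  using assms
proof (induction xs arbitrary: thesis)
  case (Cons z zs)
  from Cons.prems(2) consider "x = z" "y \<in> set zs" "R x y" | "(x, y) \<in> precedence R zs" by auto
  then show ?case
  proof cases
    case 1
    then obtain j where "j < length zs" "y = zs ! j" by (metis in_set_conv_nth)
    then show ?thesis using Cons.prems(1)[of 0 "Suc j"] 1 by simp
  next
    case 2
    from Cons.IH[OF _ this] obtain i j
      where "i < j" "j < length zs" "x = zs ! i" "y = zs ! j" "R x y" by blast
    then show ?thesis using Cons.prems(1)[of "Suc i" "Suc j"] by simp
  qed
qed simp

lemma precedence_asym:
  assumes "distinct xs" "(x, y) \<in> precedence R xs"
  shows "(y, x) \<notin> precedence R xs"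
  using assms
proof (induction xs)
  case (Cons z zs)
  then show ?case using precedence_subset[of R zs] by auto
qed simp

lemma precedence_total:
  assumes "x \<in> set xs" "y \<in> set xs" "x \<noteq> y" "R x y" "R y x"
  shows "(x, y) \<in> precedence R xs \<or> (y, x) \<in> precedence R xs"
proof -
  obtain i j where "i < length xs" "j < length xs" "x = xs ! i" "y = xs ! j"
    using assms(1,2) by (metis in_set_conv_nth)
  then show ?thesis
    using assms(3-5) nth_mem_precedence[of i j xs R] nth_mem_precedence[of j i xs R]
    by (cases i j rule: linorder_cases) auto
qed

text \<open>The list order is transitive but \<open>R\<close> need not be, so \<open>R x z\<close>
  has to be supplied.\<close>

lemma precedence_trans:
  assumes "distinct xs" "(x, y) \<in> precedence R xs" "(y, z) \<in> precedence R xs" "R x z"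
  shows "(x, z) \<in> precedence R xs"
proof -
  obtain i j where ij: "i < j" "j < length xs" "x = xs ! i" "y = xs ! j"
    using assms(2) by (rule precedence_nthE)
  obtain k l where kl: "k < l" "l < length xs" "y = xs ! k" "z = xs ! l"
    using assms(3) by (rule precedence_nthE)
  have "j = k" using ij kl assms(1) nth_eq_iff_index_eq[of xs j k] by simp
  then show ?thesis using ij kl assms(4) nth_mem_precedence[of i l xs R] by simp
qed

text \<open>Serves to insert a new element behind exactly \<open>k\<close> of its
  neighbours.\<close>

lemma split_at_count:
  assumes "k \<le> length (filter P xs)"
  shows "\<exists>ys zs. xs = ys @ zs \<and> length (filter P ys) = k"
  using assms
proof (induction xs arbitrary: k)
  case (Cons x xs)
  show ?case
  proof (cases k)
    case 0
    then show ?thesis by (intro exI[of _ "[]"] exI[of _ "x # xs"]) simp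
  next
    case (Suc m)
    then have "(if P x then m else k) \<le> length (filter P xs)" using Cons.prems by auto
    from Cons.IH[OF this] obtain ys zs
      where "xs = ys @ zs" "length (filter P ys) = (if P x then m else k)" by blast
    then show ?thesis using Suc by (intro exI[of _ "x # ys"] exI[of _ zs]) auto
  qed
qed simp

text \<open>The neighbours of \<open>p\<close> form a clique, so \<open>precedence\<close> orders them linearly and the set of those
  before \<open>p\<close> is determined by its size.\<close>

lemma bij_betw_precedence_insert:
  fixes R :: "'a \<Rightarrow> 'a \<Rightarrow> bool" and I :: "'a set"
  assumes fin: "finite I" and p: "p \<notin> I" and sym: "\<And>x y. R x y \<Longrightarrow> R y x"
    and clique: "\<And>x y. x \<in> I \<Longrightarrow> y \<in> I \<Longrightarrow> R x p \<Longrightarrow> R y p \<Longrightarrow> R x y"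
  shows "bij_betw (\<lambda>Q. (Q \<inter> I \<times> I, card {q. (q, p) \<in> Q}))
    (precedence R ` permutations_of_set (insert p I))
    (precedence R ` permutations_of_set I \<times> {..card {q \<in> I. R q p}})"
    (is "bij_betw ?f (?F (insert p I)) (?F I \<times> {..card ?N})")
proof -
  have split: "\<exists>xs ys. zs = xs @ p # ys \<and> xs @ ys \<in> permutations_of_set I"
    if zs: "zs \<in> permutations_of_set (insert p I)" for zs
  proof -
    have "p \<in> set zs" using zs by (auto simp: permutations_of_set_def)
    then obtain xs ys where *: "zs = xs @ p # ys" by (meson split_list)
    then have "xs @ ys \<in> permutations_of_set I" using zs p by (auto simp: permutations_of_set_def)
    with * show ?thesis by blast
  qed
  have restrict: "?f (precedence R (xs @ p # ys)) = (precedence R (xs @ ys), card (?N \<inter> set xs))"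
    if "xs @ ys \<in> permutations_of_set I" for xs ys
  proof -
    have I: "set xs \<union> set ys = I" "set xs \<inter> set ys = {}"
      using that by (auto simp: permutations_of_set_def)
    have "precedence R (xs @ p # ys) \<inter> I \<times> I = precedence R (xs @ ys)"
      using p I precedence_subset[of R xs] precedence_subset[of R ys]
      by (auto simp: precedence_append)
    moreover have "{q. (q, p) \<in> precedence R (xs @ p # ys)} = ?N \<inter> set xs"
      using p I precedence_subset[of R xs] precedence_subset[of R ys]
      by (auto simp: precedence_append)
    ultimately show ?thesis by simp
  qed
  have inj: "inj_on ?f (?F (insert p I))"
  proof (rule inj_onI)
    fix Q Q' assume Q: "Q \<in> ?F (insert p I)" "Q' \<in> ?F (insert p I)" and eq: "?f Q = ?f Q'"
    obtain xs ys where xs: "Q = precedence R (xs @ p # ys)" "xs @ ys \<in> permutations_of_set I"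
      using Q(1) split by blast
    obtain xs' ys' where xs': "Q' = precedence R (xs' @ p # ys')" "xs' @ ys' \<in> permutations_of_set I"
      using Q(2) split by blast
    have same: "precedence R (xs @ ys) = precedence R (xs' @ ys')"
      and cards: "card (?N \<inter> set xs) = card (?N \<inter> set xs')"
      using eq restrict[OF xs(2)] restrict[OF xs'(2)] xs(1) xs'(1) by auto
    have I: "set xs \<union> set ys = I" "set xs' \<union> set ys' = I" "distinct (xs @ ys)"
      "set xs \<inter> set ys = {}" "set xs' \<inter> set ys' = {}"
      using xs(2) xs'(2) by (auto simp: permutations_of_set_def)
    \<comment> \<open>Otherwise some neighbour \<open>x\<close> precedes \<open>p\<close> only in
      the first list and some \<open>y\<close> only in the second. They are related by the clique
      condition, and the two lists would order them oppositely.\<close>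
    have "?N \<inter> set xs \<subseteq> ?N \<inter> set xs' \<or> ?N \<inter> set xs' \<subseteq> ?N \<inter> set xs"
    proof (rule ccontr)
      assume "\<not> ?thesis"
      then obtain x y where "x \<in> ?N" "x \<in> set xs" "x \<notin> set xs'" "y \<in> ?N" "y \<in> set xs'" "y \<notin> set xs"
        by blast
      then have "(x, y) \<in> precedence R (xs @ ys)" "(y, x) \<in> precedence R (xs' @ ys')"
        using I clique[of x y] clique[of y x] by (auto simp: precedence_append)
      then show False using same precedence_asym[OF I(3)] by blast
    qed
    then have before: "?N \<inter> set xs = ?N \<inter> set xs'"
      using cards card_subset_eq[of "?N \<inter> set xs'" "?N \<inter> set xs"]
        card_subset_eq[of "?N \<inter> set xs" "?N \<inter> set xs'"] by auto
    then have after: "?N \<inter> set ys = ?N \<inter> set ys'" using I by blast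
    have "precedence R (us @ p # vs) = precedence R (us @ vs) \<union> {(q, p) | q. q \<in> ?N \<inter> set us} \<union>
        {(p, q) | q. q \<in> ?N \<inter> set vs}" if "set us \<union> set vs = I" for us vs
      using that sym by (auto simp: precedence_append)
    from this[OF I(1)] this[OF I(2)] show "Q = Q'" using xs(1) xs'(1) same before after by simp
  qed
  have "?f ` ?F (insert p I) = ?F I \<times> {..card ?N}"
  proof (intro equalityI subsetI)
    fix w assume "w \<in> ?f ` ?F (insert p I)"
    then obtain xs ys where *: "xs @ ys \<in> permutations_of_set I" "w = ?f (precedence R (xs @ p # ys))"
      using split by blast
    have "card (?N \<inter> set xs) \<le> card ?N" using fin by (intro card_mono) auto
    then show "w \<in> ?F I \<times> {..card ?N}" using * restrict[OF *(1)] by auto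
  next
    fix w assume "w \<in> ?F I \<times> {..card ?N}"
    then obtain zs k where w: "w = (precedence R zs, k)" "zs \<in> permutations_of_set I" "k \<le> card ?N"
      by auto
    have count: "length (filter (\<lambda>q. R q p) us) = card {q \<in> set us. R q p}" if "distinct us" for us
      using that by (metis distinct_card distinct_filter set_filter)
    have zs: "set zs = I" "distinct zs" using w(2) by (auto simp: permutations_of_set_def)
    then have "k \<le> length (filter (\<lambda>q. R q p) zs)" using w(3) count by simp
    from split_at_count[OF this] obtain xs ys
      where xy: "zs = xs @ ys" "length (filter (\<lambda>q. R q p) xs) = k" by blast
    have "?N \<inter> set xs = {q \<in> set xs. R q p}" using zs xy by auto
    then have "card (?N \<inter> set xs) = k" using count[of xs] zs xy by simp
    then have "w = ?f (precedence R (xs @ p # ys))" using restrict[of xs ys] w xy by simp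
    moreover have "xs @ p # ys \<in> permutations_of_set (insert p I)"
      using zs xy p by (auto simp: permutations_of_set_def)
    ultimately show "w \<in> ?f ` ?F (insert p I)" by blast
  qed
  with inj show ?thesis by (simp add: bij_betw_def)
qed

text \<open>The product formula for the acyclic orientations of a chordal graph: in the order of
  left ends, the earlier neighbours of each interval form a clique.\<close>

lemma card_precedence_intervals:
  assumes "finite I" "inj_on fst I" "\<And>p. p \<in> I \<Longrightarrow> fst p < snd p"
  shows "card (precedence overlap ` permutations_of_set I) =
    (\<Prod>p\<in>I. Suc (card {q \<in> I. fst q < fst p \<and> fst p < snd q}))"
  using assms
proof (induction "card I" arbitrary: I)
  case 0
  then show ?case by simp
next
  case (Suc n)
  then have "fst ` I \<noteq> {}" "finite (fst ` I)" by auto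
  then obtain p where p: "p \<in> I" "fst p = Max (fst ` I)" by (metis Max_in imageE)
  define J where "J = I - {p}"
  have J: "I = insert p J" "p \<notin> J" "finite J" using p Suc.prems by (auto simp: J_def)
  have lt: "fst q < fst p" if "q \<in> J" for q
  proof -
    have "fst q \<le> fst p" using p that Suc.prems(1) by (auto simp: J_def)
    moreover have "fst q \<noteq> fst p" using Suc.prems(2) J that unfolding inj_on_def by blast
    ultimately show ?thesis by simp
  qed
  have pos: "fst q < snd q" if "q \<in> I" for q using Suc.prems(3) that .
  have ov: "overlap q p \<longleftrightarrow> fst p < snd q" if "q \<in> J" for q
    using lt[OF that] pos[of p] J by (auto simp: overlap_def)
  have bij: "bij_betw (\<lambda>Q. (Q \<inter> J \<times> J, card {q. (q, p) \<in> Q}))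
      (precedence overlap ` permutations_of_set (insert p J))
      (precedence overlap ` permutations_of_set J \<times> {..card {q \<in> J. overlap q p}})"
  \<comment> \<open>The clique condition holds because the neighbours of \<open>p\<close> start to
    the left of \<open>fst p\<close> and end beyond it, so any two of them overlap there.\<close>
  proof (rule bij_betw_precedence_insert[OF J(3) J(2)])
    fix x y assume "x \<in> J" "y \<in> J" "overlap x p" "overlap y p"
    then show "overlap x y" using ov lt[of x] lt[of y] by (fastforce simp: overlap_def)
  qed (auto simp: overlap_def)
  have IH: "card (precedence overlap ` permutations_of_set J) =
      (\<Prod>p\<in>J. Suc (card {q \<in> J. fst q < fst p \<and> fst p < snd q}))"
    using Suc J by (intro Suc.hyps(1)) (auto simp: inj_on_def)
  \<comment> \<open>As \<open>p\<close> has the largest left end, it enters no factor other than its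
    own.\<close>
  have "{q \<in> I. fst q < fst r \<and> fst r < snd q} = {q \<in> J. fst q < fst r \<and> fst r < snd q}"
    if "r \<in> J" for r using lt[OF that] J(1) by auto
  then have "(\<Prod>r\<in>J. Suc (card {q \<in> I. fst q < fst r \<and> fst r < snd q})) =
      (\<Prod>r\<in>J. Suc (card {q \<in> J. fst q < fst r \<and> fst r < snd q}))"
    by (intro prod.cong) auto
  moreover have "{q \<in> I. fst q < fst p \<and> fst p < snd q} = {q \<in> J. overlap q p}"
    using ov lt J(1) by auto
  ultimately show ?case
    using bij_betw_same_card[OF bij] IH J by (simp add: card_cartesian_product)
qed

section \<open>Counting the perfect matchings that pair each left end with a larger right
  end\<close>

definition rising_matchings :: "'a::linorder set \<Rightarrow> 'a set \<Rightarrow> ('a \<times> 'a) set set" where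
  "rising_matchings A B =
    {I. fst ` I = A \<and> snd ` I = B \<and> inj_on fst I \<and> inj_on snd I \<and> (\<forall>p\<in>I. fst p < snd p)}"

lemma rising_matchings_insert:
  assumes "u \<notin> A"
  shows "rising_matchings (insert u A) B =
    (\<Union>v \<in> {v \<in> B. u < v}. insert (u, v) ` rising_matchings A (B - {v}))"
proof (intro equalityI subsetI)
  fix I assume I: "I \<in> rising_matchings (insert u A) B"
  then have "u \<in> fst ` I" by (simp add: rising_matchings_def)
  then obtain v where v: "(u, v) \<in> I" by force
  define J where "J = I - {(u, v)}"
  have IJ: "I = insert (u, v) J" using v by (auto simp: J_def)
  have inj: "inj_on fst I" "inj_on snd I" using I by (auto simp: rising_matchings_def)
  have img: "fst ` I = insert u A" "snd ` I = B" "\<forall>p\<in>I. fst p < snd p"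
    using I unfolding rising_matchings_def by blast+
  have "fst ` J = fst ` I - {u}" "snd ` J = snd ` I - {v}"
    unfolding J_def using inj v by (simp_all add: inj_on_image_set_diff)
  then have "fst ` J = A" "snd ` J = B - {v}" using img assms by simp_all
  moreover have "inj_on fst J" "inj_on snd J" using inj by (simp_all add: J_def inj_on_diff)
  moreover have "\<forall>p\<in>J. fst p < snd p" using img(3) by (simp add: J_def)
  ultimately have "J \<in> rising_matchings A (B - {v})" unfolding rising_matchings_def by simp
  moreover have "v \<in> B" using imageI[OF v, of snd] img(2) by simp
  moreover have "u < v" using bspec[OF img(3) v] by simp
  ultimately show "I \<in> (\<Union>v \<in> {v \<in> B. u < v}. insert (u, v) ` rising_matchings A (B - {v}))"
    unfolding IJ by (intro UN_I[of v] CollectI conjI imageI)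
next
  fix I assume "I \<in> (\<Union>v \<in> {v \<in> B. u < v}. insert (u, v) ` rising_matchings A (B - {v}))"
  then obtain v J where J: "v \<in> B" "u < v" "I = insert (u, v) J" "J \<in> rising_matchings A (B - {v})"
    by (elim UN_E imageE CollectE conjE)
  then have *: "fst ` J = A" "snd ` J = B - {v}" "inj_on fst J" "inj_on snd J"
    "\<forall>p\<in>J. fst p < snd p"
    unfolding rising_matchings_def by blast+
  have "inj_on fst I" "inj_on snd I"
    unfolding J(3) using * assms by (auto simp: inj_on_insert)
  then show "I \<in> rising_matchings (insert u A) B"
    using * J(1,2) unfolding rising_matchings_def J(3) by auto
qed

lemma rising_matchings_subset: "rising_matchings A B \<subseteq> Pow (A \<times> B)"
  by (force simp: rising_matchings_def)

text \<open>Partners are chosen for the largest \<open>u\<close> first. Every larger element of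
  \<open>A\<close> has by then used up a partner that also lies beyond \<open>u\<close>, so the
  number of free choices does not depend on the earlier ones. This is the count of full rook
  placements on a Ferrers board.\<close>

lemma card_rising_matchings:
  fixes A B :: "'a::linorder set"
  assumes "finite A" "finite B" "card A = card B"
  shows "card (rising_matchings A B) = (\<Prod>u\<in>A. card {v \<in> B. u < v} - card {w \<in> A. u < w})"
  using assms
proof (induction A arbitrary: B rule: finite_linorder_max_induct)
  case empty
  then have "rising_matchings {} B = {{}}" by (auto simp: rising_matchings_def)
  then show ?case by simp
next
  case (insert u A)
  let ?V = "{v \<in> B. u < v}"
  have u: "u \<notin> A" using insert.hyps by auto
  have fin: "finite (rising_matchings A (B - {v}))" for v
    by (rule finite_subset[OF rising_matchings_subset]) (use insert in simp)
  have part: "card (insert (u, v) ` rising_matchings A (B - {v})) =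
      (\<Prod>x\<in>A. card {v \<in> B. x < v} - card {w \<in> insert u A. x < w})" if v: "v \<in> ?V" for v
  proof -
    have "inj_on (insert (u, v)) (rising_matchings A (B - {v}))"
    proof (rule inj_onI)
      fix J K assume JK: "J \<in> rising_matchings A (B - {v})" "K \<in> rising_matchings A (B - {v})"
        and eq: "insert (u, v) J = insert (u, v) K"
      have "u \<notin> fst ` J" "u \<notin> fst ` K" using JK u by (auto simp: rising_matchings_def)
      then have "(u, v) \<notin> J" "(u, v) \<notin> K" by force+
      then show "J = K" using eq by (metis insert_ident)
    qed
    then have "card (insert (u, v) ` rising_matchings A (B - {v})) =
        card (rising_matchings A (B - {v}))"
      by (rule card_image)
    also have "\<dots> = (\<Prod>x\<in>A. card {y \<in> B - {v}. x < y} - card {w \<in> A. x < w})"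
      using insert.prems u v insert.hyps by (intro insert.IH) auto
    also have "\<dots> = (\<Prod>x\<in>A. card {v \<in> B. x < v} - card {w \<in> insert u A. x < w})"
    proof (rule prod.cong)
      fix x assume x: "x \<in> A"
      \<comment> \<open>As \<open>x < u < v\<close>, removing the pair lowers both counts beyond
        \<open>x\<close> by one, which leaves their truncated difference unchanged.\<close>
      then have "{y \<in> B. x < y} = insert v {y \<in> B - {v}. x < y}"
        "{w \<in> insert u A. x < w} = insert u {w \<in> A. x < w}"
        using insert.hyps v by (auto intro: less_trans)
      then show "card {y \<in> B - {v}. x < y} - card {w \<in> A. x < w} =
          card {v \<in> B. x < v} - card {w \<in> insert u A. x < w}"
        using insert.hyps insert.prems u by simp
    qed simp
    finally show ?thesis .
  qed
  have disj: "insert (u, v) ` rising_matchings A (B - {v}) \<inter>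
      insert (u, v') ` rising_matchings A (B - {v'}) = {}" if "v \<noteq> v'" for v v'
  proof -
    have "u \<notin> fst ` J" if "J \<in> rising_matchings A B'" for J B'
      using that u by (auto simp: rising_matchings_def)
    then have "(u, v) \<notin> J" if "J \<in> rising_matchings A (B - {v'})" for J using that by force
    then show ?thesis using that by blast
  qed
  have empty: "{w \<in> insert u A. u < w} = {}" using insert.hyps by auto
  have "card (rising_matchings (insert u A) B) =
      (\<Sum>v\<in>?V. card (insert (u, v) ` rising_matchings A (B - {v})))"
    unfolding rising_matchings_insert[OF u]
    using insert.prems fin disj by (intro card_UN_disjoint) auto
  also have "\<dots> = card ?V * (\<Prod>x\<in>A. card {v \<in> B. x < v} - card {w \<in> insert u A. x < w})"
    using part by simp
  also have "card ?V * (\<Prod>x\<in>A. card {v \<in> B. x < v} - card {w \<in> insert u A. x < w}) =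
      (\<Prod>x\<in>insert u A. card {v \<in> B. x < v} - card {w \<in> insert u A. x < w})"
    using insert.hyps u by (subst prod.insert) (simp_all only: empty card.empty diff_zero not_False_eq_True)
  finally show ?case .
qed

text \<open>The two products agree factor by factor. A right end beyond \<open>fst p\<close> belongs
  to \<open>p\<close>, to an interval over \<open>fst p\<close>, or to an interval starting beyond
  \<open>fst p\<close>; subtracting the left ends beyond \<open>fst p\<close> removes the last kind
  and leaves one plus the number of intervals over \<open>fst p\<close>.\<close>

lemma card_precedence_eq_card_rising_matchings:
  assumes "finite I" "I \<in> rising_matchings A B"
  shows "card (precedence overlap ` permutations_of_set I) = card (rising_matchings A B)"
proof -
  have I: "fst ` I = A" "snd ` I = B" "inj_on fst I" "inj_on snd I" "\<And>p. p \<in> I \<Longrightarrow> fst p < snd p"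
    using assms(2) by (auto simp: rising_matchings_def)
  have "card A = card B" using I card_image by metis
  then have "card (rising_matchings A B) = (\<Prod>u\<in>A. card {v \<in> B. u < v} - card {w \<in> A. u < w})"
    using assms I by (intro card_rising_matchings) auto
  also have "\<dots> = (\<Prod>p\<in>I. card {v \<in> B. fst p < v} - card {w \<in> A. fst p < w})"
    unfolding I(1)[symmetric] by (rule prod.reindex_cong[OF I(3)]) auto
  also have "\<dots> = (\<Prod>p\<in>I. Suc (card {q \<in> I. fst q < fst p \<and> fst p < snd q}))"
  proof (rule prod.cong)
    fix p assume p: "p \<in> I"
    let ?N = "{q \<in> I. fst q < fst p \<and> fst p < snd q}" and ?L = "{q \<in> I. fst p < fst q}"
    have "{v \<in> B. fst p < v} = snd ` {q \<in> I. fst p < snd q}"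
      "{v \<in> A. fst p < v} = fst ` ?L"
      using I by auto
    then have "card {v \<in> B. fst p < v} = card {q \<in> I. fst p < snd q}"
      "card {w \<in> A. fst p < w} = card ?L"
      using I by (simp_all add: card_image inj_on_subset)
    moreover have "{q \<in> I. fst p < snd q} = insert p (?N \<union> ?L)"
    proof (intro equalityI subsetI)
      fix q assume q: "q \<in> {q \<in> I. fst p < snd q}"
      then have "fst q = fst p \<Longrightarrow> q = p" using I(3) p by (auto simp: inj_on_def)
      then show "q \<in> insert p (?N \<union> ?L)" using q by force
    next
      fix q assume "q \<in> insert p (?N \<union> ?L)"
      then show "q \<in> {q \<in> I. fst p < snd q}" using p I(5)[of p] I(5)[of q] by auto
    qed
    moreover have "card (insert p (?N \<union> ?L)) = Suc (card ?N + card ?L)"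
      using assms(1) by (subst card_insert_disjoint) (auto intro!: card_Un_disjoint)
    ultimately show "card {v \<in> B. fst p < v} - card {w \<in> A. fst p < w} = Suc (card ?N)" by simp
  qed simp
  also have "\<dots> = card (precedence overlap ` permutations_of_set I)"
    using card_precedence_intervals[OF assms(1) I(3,5)] by simp
  finally show ?thesis by simp
qed

section \<open>Rank and snakes\<close>

lemma beads_from_step_int:
  "is_partition \<alpha> \<Longrightarrow> int (beads_from \<alpha> c) = int (beads_from \<alpha> (c + 1)) + of_bool (c \<in> beads \<alpha>)"
  by (simp add: beads_from_step[of \<alpha> c])

text \<open>The increment of the code of \<open>\<mu>\<close>: 1 where its path turns from up to
  right, the place of an outside corner, and -1 at the opposite turn, that of an inside
  corner.\<close>

definition corner_weight :: "(nat \<Rightarrow> nat) \<Rightarrow> int \<Rightarrow> int" where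
  "corner_weight \<mu> c = of_bool (c \<notin> beads \<mu>) - of_bool (c - 1 \<notin> beads \<mu>)"

text \<open>Row \<open>beads_from mu c + 1\<close> is the first that the diagram can have on
  diagonal \<open>c\<close>. A corner sits there, so its diagonal comprises all squares of its
  content.\<close>

lemma Union_diagonals:
  assumes "is_partition lam" "is_partition mu"
    and P: "\<And>i j. P (i, j) \<longleftrightarrow>
      (i, j) \<in> skew lam mu \<and> i = int (beads_from mu (j - i)) + 1 \<and> W (j - i)"
  shows "(\<Union>c \<in> {c. P c}. diagonal (skew lam mu) c) = {s \<in> skew lam mu. W (content s)}"
proof (intro equalityI subsetI)
  fix s assume "s \<in> (\<Union>c \<in> {c. P c}. diagonal (skew lam mu) c)"
  then obtain i j where "P (i, j)" "s \<in> diagonal (skew lam mu) (i, j)" by auto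
  then show "s \<in> {s \<in> skew lam mu. W (content s)}" using P by (auto simp: diagonal_def)
next
  fix s assume "s \<in> {s \<in> skew lam mu. W (content s)}"
  then obtain i j where s: "s = (i, j)" "(i, j) \<in> skew lam mu" "W (j - i)" by (cases s) auto
  define k where "k = int (beads_from mu (j - i)) + 1"
  have mem: "(k, k + (j - i)) \<in> skew lam mu" "k \<le> i"
    using s(2) by (auto simp: mem_skew_iff[OF assms(1,2)] k_def)
  then have "P (k, k + (j - i))" using P s(3) by (simp add: k_def)
  moreover have "s \<in> diagonal (skew lam mu) (k, k + (j - i))"
    using s mem by (auto simp: diagonal_def intro!: exI[of _ "i - k"])
  ultimately show "s \<in> (\<Union>c \<in> {c. P c}. diagonal (skew lam mu) c)" by blast
qed

context
  fixes lam mu :: "nat \<Rightarrow> nat"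
  assumes lam: "is_partition lam" and mu: "is_partition mu" and cont: "contained mu lam"
begin

text \<open>The upper and the left neighbour of a square of the diagram satisfy the outer bound
  automatically and can fail only the one from \<open>mu\<close>. So the code of \<open>mu\<close>
  at two consecutive positions decides.\<close>

lemma outside_top_corner_skew_iff:
  "outside_top_corner (skew lam mu) (i, j) \<longleftrightarrow>
    (i, j) \<in> skew lam mu \<and> i = int (beads_from mu (j - i)) + 1 \<and> corner_weight mu (j - i) = 1"
proof -
  have c: "j - (i - 1) = j - i + 1" "j - 1 - i = j - i - 1" "j - i - 1 + 1 = j - i" by simp_all
  show ?thesis
    using beads_from_step_int[OF lam, of "j - i"] beads_from_step_int[OF lam, of "j - i - 1"]
      beads_from_step_int[OF mu, of "j - i"] beads_from_step_int[OF mu, of "j - i - 1"]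
    unfolding outside_top_corner_def prod.case mem_skew_iff[OF lam mu] corner_weight_def c
    by (auto simp: of_bool_def split: if_splits)
qed

lemma inside_top_corner_skew_iff:
  "inside_top_corner (skew lam mu) (i, j) \<longleftrightarrow>
    (i, j) \<in> skew lam mu \<and> i = int (beads_from mu (j - i)) + 1 \<and> corner_weight mu (j - i) = -1"
proof -
  have c: "j - (i - 1) = j - i + 1" "j - 1 - i = j - i - 1" "j - i - 1 + 1 = j - i"
    "j - 1 - (i - 1) = j - i" by simp_all
  show ?thesis
    using beads_from_step_int[OF lam, of "j - i"] beads_from_step_int[OF lam, of "j - i - 1"]
      beads_from_step_int[OF mu, of "j - i"] beads_from_step_int[OF mu, of "j - i - 1"]
    unfolding inside_top_corner_def prod.case mem_skew_iff[OF lam mu] corner_weight_def c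
    by (auto simp: of_bool_def split: if_splits)
qed

lemma skew_rank_eq_sum: "skew_rank lam mu = (\<Sum>s\<in>skew lam mu. corner_weight mu (content s))"
proof -
  let ?w = "\<lambda>s. corner_weight mu (content s)"
  have fin: "finite (skew lam mu)" by (rule finite_skew[OF lam])
  have "?w s = of_bool (?w s = 1) - of_bool (?w s = -1)" for s
    by (auto simp: corner_weight_def)
  then have "(\<Sum>s\<in>skew lam mu. ?w s) =
      (\<Sum>s\<in>skew lam mu. of_bool (?w s = 1)) - (\<Sum>s\<in>skew lam mu. of_bool (?w s = -1))"
    by (subst sum_subtractf[symmetric]) (intro sum.cong; simp)
  also have "\<dots> = int (card {s \<in> skew lam mu. ?w s = 1}) - int (card {s \<in> skew lam mu. ?w s = -1})"
    using fin by (simp add: sum_of_bool_eq Int_def)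
  also have "\<dots> = skew_rank lam mu"
    using Union_diagonals[OF lam mu outside_top_corner_skew_iff]
      Union_diagonals[OF lam mu inside_top_corner_skew_iff]
    by (simp add: skew_rank_def)
  finally show ?thesis by simp
qed

text \<open>On a border strip with contents \<open>a, \<dots>, b\<close> the corner weights telescope to a difference of two
  code entries.\<close>

lemma skew_rank_le_card_decomposition:
  assumes "bs_decomposition lam mu D"
  shows "skew_rank lam mu \<le> int (card D)"
proof -
  have D: "\<Union>D = skew lam mu" "disjoint D" "\<And>B. B \<in> D \<Longrightarrow> border_strip B"
    using assms by (auto simp: bs_decomposition_def partition_on_def)
  have fin: "finite B" if "B \<in> D" for B
    using that D(1) finite_skew[OF lam] by (metis Union_upper finite_subset)
  have strip: "(\<Sum>s\<in>B. corner_weight mu (content s)) \<le> 1" if B: "B \<in> D" for B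
  proof -
    obtain a b where ab: "a \<le> b" "bij_betw content B {a..b}" using border_stripE[OF D(3)[OF B]] .
    have "(\<Sum>s\<in>B. corner_weight mu (content s)) = (\<Sum>c\<in>{a..b}. corner_weight mu c)"
      by (rule sum.reindex_bij_betw[OF ab(2)])
    also have "\<dots> = of_bool (b \<notin> beads mu) - of_bool (a - 1 \<notin> beads mu)"
      using ab(1)
    proof (induction b rule: int_ge_induct)
      case (step b)
      have "{a..b + 1} = insert (b + 1) {a..b}" using step.hyps by auto
      then show ?case using step.IH by (simp add: corner_weight_def)
    qed (simp add: corner_weight_def)
    finally show ?thesis by simp
  qed
  have "skew_rank lam mu = (\<Sum>B\<in>D. \<Sum>s\<in>B. corner_weight mu (content s))"
    unfolding skew_rank_eq_sum D(1)[symmetric]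
    using fin D(2) by (subst sum.Union_disjoint) (auto simp: disjoint_def)
  also have "\<dots> \<le> (\<Sum>B\<in>D. 1)" using strip by (rule sum_mono)
  finally show ?thesis by simp
qed

text \<open>With \<open>d c\<close> the size of diagonal \<open>c\<close>, the rank is the sum of
  \<open>d c * corner_weight mu c\<close>. Both the weight and the change of \<open>d\<close> are
  code differences, so summation by parts moves the difference onto \<open>d\<close> and leaves one
  unit for each bead gained.\<close>

lemma
  shows finite_beads_diff: "finite (beads lam - beads mu)" "finite (beads mu - beads lam)"
    and card_beads_diff: "int (card (beads lam - beads mu)) = skew_rank lam mu"
      "int (card (beads mu - beads lam)) = skew_rank lam mu"
proof -
  define d where "d c = int (beads_from lam c) - int (beads_from mu c)" for c
  have fin: "finite (skew lam mu)" by (rule finite_skew[OF lam])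
  have card_d: "int (card {s \<in> skew lam mu. content s = c}) = d c" for c
    using beads_from_mono[OF lam cont, of c] by (simp add: card_skew_diagonal[OF lam mu] d_def)
  have step: "d c - d (c + 1) = of_bool (c \<in> beads lam) - of_bool (c \<in> beads mu)" for c
    using beads_from_step_int[OF lam, of c] beads_from_step_int[OF mu, of c] by (simp add: d_def)
  have "bdd_above ((\<lambda>s. \<bar>content s\<bar>) ` skew lam mu)" using fin by (intro bdd_above_finite) simp
  then obtain m where "\<And>s. s \<in> skew lam mu \<Longrightarrow> \<bar>content s\<bar> \<le> m"
    by (auto simp: bdd_above_def)
  then obtain n where n: "\<And>s. s \<in> skew lam mu \<Longrightarrow> \<bar>content s\<bar> < n"
    using zle_add1_eq_le by metis
  have d0: "d c = 0" if "n \<le> \<bar>c\<bar>" for c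
  proof -
    have "{s \<in> skew lam mu. content s = c} = {}" using n that by force
    then show ?thesis using card_d[of c] by (simp only: card.empty of_nat_0)
  qed
  let ?C = "{- n..n}"
  have sub: "{c. d c \<noteq> d (c + 1)} \<subseteq> ?C"
  proof
    fix c assume "c \<in> {c. d c \<noteq> d (c + 1)}"
    then have "\<not> (n \<le> \<bar>c\<bar> \<and> n \<le> \<bar>c + 1\<bar>)" using d0[of c] d0[of "c + 1"] by auto
    then show "c \<in> ?C" by auto
  qed
  have "c \<in> ?C" if "(c \<in> beads lam) \<noteq> (c \<in> beads mu)" for c
  proof -
    have "d c \<noteq> d (c + 1)" using step[of c] that by auto
    then show ?thesis using sub by blast
  qed
  then have diff_sub: "beads lam - beads mu \<subseteq> ?C" "beads mu - beads lam \<subseteq> ?C" by blast+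
  then show fins: "finite (beads lam - beads mu)" "finite (beads mu - beads lam)"
    by (auto intro: finite_subset)
  \<comment> \<open>The shift affects only the terms at \<open>- n\<close> and \<open>n + 1\<close>,
    where \<open>d\<close> vanishes, so there are no boundary terms.\<close>
  have shift: "(\<Sum>c\<in>?C. d c * g c) = (\<Sum>c\<in>?C. d (c + 1) * g (c + 1))" for g :: "int \<Rightarrow> int"
  proof -
    have "(\<Sum>c\<in>?C. d (c + 1) * g (c + 1)) = (\<Sum>c\<in>{- n + 1..n + 1}. d c * g c)"
      by (rule sum.reindex_bij_witness[of _ "\<lambda>c. c - 1" "\<lambda>c. c + 1"]) auto
    also have "\<dots> = (\<Sum>c\<in>{- n + 1..n}. d c * g c)"
      using d0[of "n + 1"] by (intro sum.mono_neutral_right) (auto simp: order_le_less)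
    also have "\<dots> = (\<Sum>c\<in>?C. d c * g c)"
      using d0[of "- n"] by (intro sum.mono_neutral_left) (auto simp: order_le_less)
    finally show ?thesis by simp
  qed
  have parts: "(\<Sum>c\<in>?C. d c * (g c - g (c - 1))) =
      (\<Sum>c\<in>?C. (of_bool (c \<in> beads lam) - of_bool (c \<in> beads mu)) * g c)" for g
    using shift[of "\<lambda>c. g (c - 1)"]
    by (simp add: step[symmetric] right_diff_distrib left_diff_distrib sum_subtractf)
  have sums: "(\<Sum>c\<in>?C. of_bool (c \<in> beads lam \<and> c \<notin> beads mu)) = int (card (beads lam - beads mu))"
    "(\<Sum>c\<in>?C. of_bool (c \<in> beads mu \<and> c \<notin> beads lam)) = int (card (beads mu - beads lam))"
    using diff_sub by (simp_all add: sum_of_bool_eq Int_absorb1 set_diff_eq[symmetric])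
  have "skew_rank lam mu = (\<Sum>c\<in>?C. \<Sum>s\<in>{s \<in> skew lam mu. content s = c}. corner_weight mu (content s))"
    unfolding skew_rank_eq_sum using n fin
    by (intro sum.group[symmetric]) (force simp: abs_less_iff)+
  also have "\<dots> = (\<Sum>c\<in>?C. d c * corner_weight mu c)"
    by (intro sum.cong) (simp_all add: card_d)
  also have "\<dots> = (\<Sum>c\<in>?C. (of_bool (c \<in> beads lam) - of_bool (c \<in> beads mu)) * of_bool (c \<notin> beads mu))"
    using parts[of "\<lambda>c. of_bool (c \<notin> beads mu)"] by (simp add: corner_weight_def)
  also have "\<dots> = (\<Sum>c\<in>?C. of_bool (c \<in> beads lam \<and> c \<notin> beads mu))"
    by (intro sum.cong) auto
  finally show rank: "int (card (beads lam - beads mu)) = skew_rank lam mu" using sums by simp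
  \<comment> \<open>The constant weight 1 shows that as many beads are lost as gained.\<close>
  have "(\<Sum>c\<in>?C. of_bool (c \<in> beads lam) - of_bool (c \<in> beads mu)) = (0 :: int)"
    using parts[of "\<lambda>c. 1"] by simp
  moreover have "(\<Sum>c\<in>?C. of_bool (c \<in> beads lam) - of_bool (c \<in> beads mu)) =
      (\<Sum>c\<in>?C. of_bool (c \<in> beads lam \<and> c \<notin> beads mu)) -
      (\<Sum>c\<in>?C. of_bool (c \<in> beads mu \<and> c \<notin> beads lam) :: int)"
    by (subst sum_subtractf[symmetric]) (intro sum.cong; simp)
  ultimately show "int (card (beads mu - beads lam)) = skew_rank lam mu" using sums rank by simp
qed

section \<open>Snakes, their parity, and interval sets as matchings\<close>

text \<open>Step \<open>k\<close> separates the diagonals \<open>k\<close> and \<open>k + 1\<close>,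
  and the snake runs up both. As the step lies on the boundary of \<open>lam\<close>, neither
  diagonal has squares below the start, so the snake exhausts them.\<close>

lemma snake_eq:
  assumes "path_step lam k \<noteq> path_step mu k"
  shows "snake lam mu k = {s \<in> skew lam mu. content s = k \<or> content s = k + 1}"
proof -
  let ?m = "int (beads_from lam k)"
  have not_shared: "path_step lam k \<notin> boundary_path mu"
    using assms path_step_in_boundary_path_iff[OF lam mu] by simp
  have row: "a \<le> ?m" if "(a, b) \<in> skew lam mu" "b - a = k" for a b
    using that mem_skew_iff[OF lam mu] by auto
  \<comment> \<open>If step \<open>k\<close> is vertical, diagonal \<open>k + 1\<close> starts one
    row higher than diagonal \<open>k\<close>.\<close>
  have row': "a \<le> ?m - of_bool (k \<in> beads lam)" if "(a, b) \<in> skew lam mu" "b - a = k + 1" for a b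
    using that mem_skew_iff[OF lam mu, of a b] beads_from_step_int[OF lam, of k] by auto
  show ?thesis
  proof (cases "k \<in> beads lam")
    case True
    have "snake lam mu k = skew lam mu \<inter>
        ({(?m - p, k + ?m - p) | p. 0 \<le> p} \<union> {(?m - 1 - p, k + ?m - p) | p. 0 \<le> p})"
      using not_shared True by (simp add: snake_def path_step_eq[OF lam] Let_def)
    also have "\<dots> = {s \<in> skew lam mu. content s = k \<or> content s = k + 1}"
    proof (intro equalityI subsetI)
      fix s assume "s \<in> {s \<in> skew lam mu. content s = k \<or> content s = k + 1}"
      then obtain a b where s: "s = (a, b)" "(a, b) \<in> skew lam mu" "b - a = k \<or> b - a = k + 1"
        by (cases s) auto
      from s(3) show "s \<in> skew lam mu \<inter>
        ({(?m - p, k + ?m - p) | p. 0 \<le> p} \<union> {(?m - 1 - p, k + ?m - p) | p. 0 \<le> p})"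
      proof
        assume c: "b - a = k"
        then show ?thesis
          using s row[OF s(2)] by (intro IntI UnI1 CollectI exI[of _ "?m - a"]) auto
      next
        assume c: "b - a = k + 1"
        then show ?thesis
          using s row'[OF s(2)] True by (intro IntI UnI2 CollectI exI[of _ "?m - 1 - a"]) auto
      qed
    qed auto
    finally show ?thesis .
  next
    case False
    have "snake lam mu k = skew lam mu \<inter>
        ({(?m - p, k + ?m + 1 - p) | p. 0 \<le> p} \<union> {(?m - p, k + ?m - p) | p. 0 \<le> p})"
      using not_shared False by (simp add: snake_def path_step_eq[OF lam] Let_def)
    also have "\<dots> = {s \<in> skew lam mu. content s = k \<or> content s = k + 1}"
    proof (intro equalityI subsetI)
      fix s assume "s \<in> {s \<in> skew lam mu. content s = k \<or> content s = k + 1}"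
      then obtain a b where s: "s = (a, b)" "(a, b) \<in> skew lam mu" "b - a = k \<or> b - a = k + 1"
        by (cases s) auto
      from s(3) show "s \<in> skew lam mu \<inter>
        ({(?m - p, k + ?m + 1 - p) | p. 0 \<le> p} \<union> {(?m - p, k + ?m - p) | p. 0 \<le> p})"
      proof
        assume c: "b - a = k"
        then show ?thesis
          using s row[OF s(2)] by (intro IntI UnI2 CollectI exI[of _ "?m - a"]) auto
      next
        assume c: "b - a = k + 1"
        then show ?thesis
          using s row'[OF s(2)] False by (intro IntI UnI1 CollectI exI[of _ "?m - a"]) auto
      qed
    qed auto
    finally show ?thesis .
  qed
qed

text \<open>The snake consists of two neighbouring diagonals, whose sizes differ by the difference
  of the code entries at \<open>k\<close>; the sum of the sizes has the same parity. For a shared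
  step the snake is empty and the codes agree.\<close>

lemma odd_card_snake_iff: "odd (card (snake lam mu k)) \<longleftrightarrow> (k \<in> beads lam) \<noteq> (k \<in> beads mu)"
proof (cases "path_step lam k = path_step mu k")
  case True
  then have "path_step lam k \<in> boundary_path mu"
    using path_step_in_boundary_path_iff[OF lam mu] by blast
  then have "snake lam mu k = {}" by (simp add: snake_def)
  moreover have "k \<in> beads lam \<longleftrightarrow> k \<in> beads mu"
    using True by (simp add: path_step_eq[OF lam] path_step_eq[OF mu] Let_def split: if_splits)
  ultimately show ?thesis by simp
next
  case False
  have "snake lam mu k = {s \<in> skew lam mu. content s = k} \<union> {s \<in> skew lam mu. content s = k + 1}"
    using snake_eq[OF False] by auto
  then have "card (snake lam mu k) =
      card {s \<in> skew lam mu. content s = k} + card {s \<in> skew lam mu. content s = k + 1}"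
    using finite_skew[OF lam] by (simp add: card_Un_disjoint disjoint_iff)
  then have "int (card (snake lam mu k)) = int (beads_from lam k) - int (beads_from mu k) +
      (int (beads_from lam (k + 1)) - int (beads_from mu (k + 1)))"
    using beads_from_mono[OF lam cont, of k] beads_from_mono[OF lam cont, of "k + 1"]
    by (simp add: card_skew_diagonal[OF lam mu])
  then have "int (card (snake lam mu k)) =
      2 * (int (beads_from lam (k + 1)) - int (beads_from mu (k + 1))) +
      (of_bool (k \<in> beads lam) - of_bool (k \<in> beads mu))"
    using beads_from_step_int[OF lam, of k] beads_from_step_int[OF mu, of k] by simp
  then have "odd (int (card (snake lam mu k))) \<longleftrightarrow> (k \<in> beads lam) \<noteq> (k \<in> beads mu)"
    by (auto simp del: of_nat_diff)
  then show ?thesis by simp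
qed

lemma snake_length_even_iff:
  "0 \<le> snake_length lam mu k \<and> even (snake_length lam mu k) \<longleftrightarrow> odd (card (snake lam mu k))"
  by (cases "card (snake lam mu k)") (auto simp: snake_length_def)

lemma left_snake_iff: "left_snake lam mu k \<longleftrightarrow> k \<in> beads mu - beads lam"
  unfolding left_snake_def snake_length_even_iff odd_card_snake_iff
  by (auto simp: path_step_eq[OF lam] Let_def)

lemma right_snake_iff: "right_snake lam mu k \<longleftrightarrow> k \<in> beads lam - beads mu"
  unfolding right_snake_def snake_length_even_iff odd_card_snake_iff
  by (auto simp: path_step_eq[OF lam] Let_def)

text \<open>The \<open>2 * card I\<close> distinct end points force \<open>fst\<close> and
  \<open>snd\<close> to be injective. Since \<open>card I\<close> is the rank, which is the size of
  either set of beads, the images fill these sets.\<close>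

lemma interval_set_iff:
  "interval_set lam mu I \<longleftrightarrow> I \<in> rising_matchings (beads mu - beads lam) (beads lam - beads mu)"
    (is "_ \<longleftrightarrow> I \<in> rising_matchings ?A ?B")
proof
  assume I: "interval_set lam mu I"
  then have fin: "finite I" and card_I: "card I = card ?A" "card I = card ?B"
    and card_Un: "card (fst ` I \<union> snd ` I) = 2 * card I"
    and sub: "fst ` I \<subseteq> ?A" "snd ` I \<subseteq> ?B" and pos: "\<forall>p\<in>I. fst p < snd p"
    using card_beads_diff by (auto simp: interval_set_def left_snake_iff right_snake_iff)
  have "2 * card I \<le> card (fst ` I) + card (snd ` I)" using card_Un card_Un_le by metis
  moreover have "card (fst ` I) \<le> card I" "card (snd ` I) \<le> card I" using fin by (auto intro: card_image_le)
  ultimately have cards: "card (fst ` I) = card I" "card (snd ` I) = card I" by linarith+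
  then have "inj_on fst I" "inj_on snd I" using fin by (auto intro: eq_card_imp_inj_on)
  moreover have "fst ` I = ?A" using finite_beads_diff(2) sub(1) by (rule card_subset_eq) (use cards card_I in simp)
  moreover have "snd ` I = ?B" using finite_beads_diff(1) sub(2) by (rule card_subset_eq) (use cards card_I in simp)
  ultimately show "I \<in> rising_matchings ?A ?B" using pos by (simp add: rising_matchings_def)
next
  assume "I \<in> rising_matchings ?A ?B"
  then have I: "fst ` I = ?A" "snd ` I = ?B" "inj_on fst I" "inj_on snd I" "\<forall>p\<in>I. fst p < snd p"
    by (simp_all add: rising_matchings_def)
  have "finite I" using I(1,3) finite_beads_diff by (metis finite_image_iff)
  moreover have "card I = card ?A" "card I = card ?B" using I by (metis card_image)+
  moreover have "card (?A \<union> ?B) = card ?A + card ?B"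
    using finite_beads_diff by (intro card_Un_disjoint) auto
  moreover have "fst p \<in> ?A" "snd p \<in> ?B" if "p \<in> I" for p using I(1,2) that by blast+
  ultimately show "interval_set lam mu I"
    using I(1,2,5) card_beads_diff
    by (auto simp: interval_set_def left_snake_iff right_snake_iff)
qed

end

section \<open>Tableaux as orderings of intervals\<close>

definition bead_move :: "(nat \<Rightarrow> nat) \<Rightarrow> (nat \<Rightarrow> nat) \<Rightarrow> int \<times> int \<Rightarrow> bool" where
  "bead_move \<beta> \<alpha> p \<longleftrightarrow> fst p < snd p \<and> fst p \<in> beads \<beta> \<and> snd p \<notin> beads \<beta> \<and>
    beads \<alpha> = insert (snd p) (beads \<beta> - {fst p})"

lemma bead_move_unique:
  assumes "bead_move \<beta> \<alpha> p" "bead_move \<beta> \<alpha> q"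
  shows "p = q"
proof -
  have "beads \<beta> - beads \<alpha> = {fst r}" "beads \<alpha> - beads \<beta> = {snd r}" if "bead_move \<beta> \<alpha> r" for r
    using that by (auto simp: bead_move_def)
  from this[OF assms(1)] this[OF assms(2)] have "fst p = fst q" "snd p = snd q" by simp_all
  then show ?thesis by (rule prod_eqI)
qed

lemma border_strip_iff_bead_move:
  assumes "is_partition \<alpha>" "is_partition \<beta>"
  shows "contained \<beta> \<alpha> \<and> border_strip (skew \<alpha> \<beta>) \<longleftrightarrow> (\<exists>p. bead_move \<beta> \<alpha> p)"
  unfolding border_strip_skew_iff[OF assms] bead_move_def by auto

lemma step_pair_iff:
  assumes "is_partition \<alpha>" "is_partition \<beta>"
  shows "step_pair \<alpha> \<beta> p \<longleftrightarrow> bead_move \<beta> \<alpha> p"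
proof -
  obtain u v where p: "p = (u, v)" by (cases p)
  have "{k. code \<alpha> k \<noteq> code \<beta> k} = {k. (k \<in> beads \<alpha>) \<noteq> (k \<in> beads \<beta>)}"
    by (auto simp: code_eq assms)
  then have "step_pair \<alpha> \<beta> p \<longleftrightarrow> u < v \<and> u \<notin> beads \<alpha> \<and> v \<in> beads \<alpha> \<and>
      {k. (k \<in> beads \<alpha>) \<noteq> (k \<in> beads \<beta>)} = {u, v}"
    by (auto simp: p step_pair_def code_eq assms)
  also have "\<dots> \<longleftrightarrow> bead_move \<beta> \<alpha> p"
  proof
    assume l: "u < v \<and> u \<notin> beads \<alpha> \<and> v \<in> beads \<alpha> \<and>
      {k. (k \<in> beads \<alpha>) \<noteq> (k \<in> beads \<beta>)} = {u, v}"
    then have diff: "(k \<in> beads \<alpha>) \<noteq> (k \<in> beads \<beta>) \<longleftrightarrow> k = u \<or> k = v" for k by blast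
    have "u \<in> beads \<beta>" "v \<notin> beads \<beta>" using diff[of u] diff[of v] l by simp_all
    moreover have "beads \<alpha> = insert v (beads \<beta> - {u})"
    proof (rule set_eqI)
      show "k \<in> beads \<alpha> \<longleftrightarrow> k \<in> insert v (beads \<beta> - {u})" for k using diff[of k] l by auto
    qed
    ultimately show "bead_move \<beta> \<alpha> p" using l by (simp add: bead_move_def p)
  qed (auto simp: bead_move_def p)
  finally show ?thesis .
qed

lemma skew_bead_move:
  assumes "is_partition \<alpha>" "is_partition \<beta>" "bead_move \<beta> \<alpha> p"
  shows "skew \<alpha> \<beta> =
    {(i, j). fst p < j - i \<and> j - i \<le> snd p \<and> i = int (beads_from \<beta> (j - i)) + 1}"
  using beads_from_bead_move[OF assms(1,2), of "snd p" "fst p"] assms(3)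
  by (auto simp: mem_skew_iff[OF assms(1,2)] bead_move_def split: if_splits)

section \<open>Chains of partitions driven by a list of bead moves\<close>

definition bead_chain :: "(nat \<Rightarrow> nat) list \<Rightarrow> (int \<times> int) list \<Rightarrow> bool" where
  "bead_chain T ps \<longleftrightarrow> length T = Suc (length ps) \<and> (\<forall>\<alpha>\<in>set T. is_partition \<alpha>) \<and>
    (\<forall>i<length ps. bead_move (T ! i) (T ! Suc i) (ps ! i))"

lemma bead_chain_nth:
  assumes "bead_chain T ps"
  shows "i \<le> length ps \<Longrightarrow> is_partition (T ! i)"
    and "i < length ps \<Longrightarrow> bead_move (T ! i) (T ! Suc i) (ps ! i)"
  using assms by (auto simp: bead_chain_def)

text \<open>The moves do not interfere: sources are occupied in \<open>\<mu>\<close>, targets are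
  free in \<open>\<mu>\<close>, and none is used twice. So each source stays occupied and each
  target free until its turn, whatever the order.\<close>

lemma bead_chain_exists:
  assumes "is_partition \<mu>" "fst ` set ps \<subseteq> beads \<mu>" "snd ` set ps \<inter> beads \<mu> = {}"
    and "distinct (map fst ps)" "distinct (map snd ps)" "\<forall>p\<in>set ps. fst p < snd p"
  shows "\<exists>T. bead_chain T ps \<and> hd T = \<mu>"
  using assms
proof (induction ps arbitrary: \<mu>)
  case Nil
  then show ?case by (intro exI[of _ "[\<mu>]"]) (simp add: bead_chain_def)
next
  case (Cons p ps)
  then obtain \<alpha> where \<alpha>: "is_partition \<alpha>" "beads \<alpha> = insert (snd p) (beads \<mu> - {fst p})"
    using bead_move_exists[of \<mu> "fst p" "snd p"] by auto
  then have move: "bead_move \<mu> \<alpha> p" using Cons.prems by (auto simp: bead_move_def)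
  have "\<exists>T. bead_chain T ps \<and> hd T = \<alpha>"
    using Cons.prems \<alpha> by (intro Cons.IH) (auto simp: image_iff)
  then obtain T where T: "bead_chain T ps" "hd T = \<alpha>" by blast
  have "T ! 0 = \<alpha>" using T by (cases T) (auto simp: bead_chain_def)
  then have "bead_chain (\<mu> # T) (p # ps)"
    using T(1) Cons.prems(1) move by (auto simp: bead_chain_def less_Suc_eq_0_disj)
  then show ?case by (intro exI[of _ "\<mu> # T"]) simp
qed

lemma bead_chain_unique:
  assumes "bead_chain T ps" "bead_chain T' ps" "hd T = hd T'"
  shows "T = T'"
proof (rule nth_equalityI)
  show len: "length T = length T'" using assms by (simp add: bead_chain_def)
  fix i assume "i < length T"
  then show "T ! i = T' ! i"
  proof (induction i)
    case 0
    then show ?case using assms(3) len by (metis hd_conv_nth length_0_conv less_numeral_extra(3))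
  next
    case (Suc i)
    then have i: "i < length ps" using assms(1) by (simp add: bead_chain_def)
    then have "beads (T ! Suc i) = beads (T' ! Suc i)"
      using bead_chain_nth(2)[OF assms(1) i] bead_chain_nth(2)[OF assms(2) i] Suc
      by (simp add: bead_move_def)
    then show ?case
      using inj_on_beads_partition bead_chain_nth(1)[OF assms(1), of "Suc i"]
        bead_chain_nth(1)[OF assms(2), of "Suc i"] i by (simp add: inj_on_def)
  qed
qed

lemma bead_chain_moves_unique:
  assumes "bead_chain T ps" "bead_chain T qs"
  shows "ps = qs"
proof (rule nth_equalityI)
  show "length ps = length qs" using assms by (simp add: bead_chain_def)
  then show "ps ! i = qs ! i" if "i < length ps" for i
    using that bead_chain_nth(2)[OF assms(1)] bead_chain_nth(2)[OF assms(2)] bead_move_unique by metis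
qed

definition moves_of :: "(nat \<Rightarrow> nat) list \<Rightarrow> (int \<times> int) list" where
  "moves_of T = (THE ps. bead_chain T ps)"

lemma moves_of_bead_chain: "bead_chain T ps \<Longrightarrow> moves_of T = ps"
  unfolding moves_of_def by (rule the_equality) (auto dest: bead_chain_moves_unique)

lemma beads_bead_chain:
  assumes "bead_chain T ps" "fst ` set ps \<inter> snd ` set ps = {}" "i \<le> length ps"
  shows "beads (T ! i) = (beads (T ! 0) - fst ` set (take i ps)) \<union> snd ` set (take i ps)"
  using assms(3)
proof (induction i)
  case (Suc i)
  then have i: "i < length ps" by simp
  have "fst (ps ! i) \<notin> snd ` set (take i ps)"
  proof -
    have "fst (ps ! i) \<in> fst ` set ps" "snd ` set (take i ps) \<subseteq> snd ` set ps"
      using i by (auto dest: in_set_takeD)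
    then show ?thesis using assms(2) by blast
  qed
  then show ?case
    using bead_chain_nth(2)[OF assms(1) i] Suc i by (auto simp: bead_move_def take_Suc_conv_app_nth)
qed simp

text \<open>Each earlier strip lengthens by one square every diagonal that it meets.\<close>

lemma beads_from_bead_chain:
  assumes "bead_chain T ps" "distinct ps" "i \<le> length ps"
  shows "beads_from (T ! i) c =
    beads_from (T ! 0) c + card {q \<in> set (take i ps). fst q < c \<and> c \<le> snd q}"
  using assms(3)
proof (induction i)
  case (Suc i)
  then have i: "i < length ps" by simp
  let ?q = "ps ! i"
  have new: "?q \<notin> set (take i ps)"
    using assms(2) i by (auto simp: in_set_conv_nth nth_eq_iff_index_eq)
  have "{q \<in> set (take (Suc i) ps). fst q < c \<and> c \<le> snd q} =
      {q \<in> set (take i ps). fst q < c \<and> c \<le> snd q} \<union>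
      (if fst ?q < c \<and> c \<le> snd ?q then {?q} else {})"
    using i by (auto simp: take_Suc_conv_app_nth)
  then have "card {q \<in> set (take (Suc i) ps). fst q < c \<and> c \<le> snd q} =
      card {q \<in> set (take i ps). fst q < c \<and> c \<le> snd q} +
      (if fst ?q < c \<and> c \<le> snd ?q then 1 else 0)"
    using new by (auto simp: card_Un_disjoint)
  moreover have "beads_from (T ! Suc i) c =
      beads_from (T ! i) c + (if fst ?q < c \<and> c \<le> snd ?q then 1 else 0)"
    using bead_chain_nth[OF assms(1)] i
    by (intro beads_from_bead_move) (simp_all add: bead_move_def)
  ultimately show ?case using Suc by simp
qed simp

lemma bs_tableau_iff_bead_chain:
  "bs_tableau lam mu T \<longleftrightarrow> (\<exists>ps. bead_chain T ps) \<and> hd T = mu \<and> last T = lam"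
proof
  assume T: "bs_tableau lam mu T"
  have part: "is_partition (T ! i)" if "i < length T" for i
    using T that by (simp add: bs_tableau_def)
  have "\<exists>p. bead_move (T ! i) (T ! Suc i) p" if "Suc i < length T" for i
  proof -
    have "contained (T ! i) (T ! Suc i) \<and> border_strip (skew (T ! Suc i) (T ! i))"
      using T that by (simp add: bs_tableau_def)
    then show ?thesis
      by (simp only: border_strip_iff_bead_move[OF part[OF that] part[OF Suc_lessD[OF that]]])
  qed
  then obtain f where f: "\<And>i. Suc i < length T \<Longrightarrow> bead_move (T ! i) (T ! Suc i) (f i)" by metis
  have "bead_chain T (map f [0..<length T - 1])"
    using T f by (auto simp: bead_chain_def bs_tableau_def)
  then show "(\<exists>ps. bead_chain T ps) \<and> hd T = mu \<and> last T = lam"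
    using T by (auto simp: bs_tableau_def)
next
  assume "(\<exists>ps. bead_chain T ps) \<and> hd T = mu \<and> last T = lam"
  then obtain ps where T: "bead_chain T ps" "hd T = mu" "last T = lam" by blast
  have "contained (T ! i) (T ! Suc i) \<and> border_strip (skew (T ! Suc i) (T ! i))"
    if "Suc i < length T" for i
  proof -
    have i: "i < length ps" using that T(1) by (simp add: bead_chain_def)
    have "is_partition (T ! i)" "is_partition (T ! Suc i)" using bead_chain_nth(1)[OF T(1)] i by auto
    then show ?thesis using border_strip_iff_bead_move bead_chain_nth(2)[OF T(1) i] by blast
  qed
  moreover have "T \<noteq> []" using T(1) by (auto simp: bead_chain_def)
  ultimately show "bs_tableau lam mu T" using T by (simp add: bs_tableau_def bead_chain_def)
qed

lemma intervals_of_bead_chain: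
  assumes "bead_chain T ps"
  shows "intervals_of T = set ps"
proof -
  have "step_pair (T ! Suc i) (T ! i) p \<longleftrightarrow> p = ps ! i" if "i < length ps" for i p
  proof -
    have "is_partition (T ! i)" "is_partition (T ! Suc i)" using bead_chain_nth(1)[OF assms] that by auto
    then show ?thesis
      using step_pair_iff bead_chain_nth(2)[OF assms that] bead_move_unique by blast
  qed
  moreover have "Suc i < length T \<longleftrightarrow> i < length ps" for i using assms by (simp add: bead_chain_def)
  ultimately have "intervals_of T = {ps ! i | i. i < length ps}" unfolding intervals_of_def by blast
  then show ?thesis by (simp add: set_conv_nth)
qed

section \<open>From tableaux to decompositions, and back to the order of overlapping strips\<close>

lemma partition_on_skew_chain:
  assumes "\<And>i. i < n \<Longrightarrow> contained (f i) (f (Suc i))"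
    and "\<And>i. i < n \<Longrightarrow> skew (f (Suc i)) (f i) \<noteq> {}"
  shows "partition_on (skew (f n) (f 0)) {skew (f (Suc i)) (f i) | i. i < n}"
    and "card {skew (f (Suc i)) (f i) | i. i < n} = n"
proof -
  have mono: "f i x \<le> f j x" if "i \<le> j" "j \<le> n" for i j x
    using that
  proof (induction j rule: dec_induct)
    case (step j)
    then have "f j x \<le> f (Suc j) x" using assms(1)[of j] by (simp add: contained_def)
    then show ?case using step by simp
  qed simp
  have union: "skew (f m) (f 0) = (\<Union>i<m. skew (f (Suc i)) (f i))" if "m \<le> n" for m
    using that
  proof (induction m)
    case 0
    then show ?case by (auto simp: skew_def)
  next
    case (Suc m)
    have "skew (f (Suc m)) (f 0) = skew (f (Suc m)) (f m) \<union> skew (f m) (f 0)"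
    proof (intro equalityI subsetI)
      fix s assume "s \<in> skew (f (Suc m)) (f m) \<union> skew (f m) (f 0)"
      then show "s \<in> skew (f (Suc m)) (f 0)"
        using mono[of 0 m "nat (fst s)"] mono[of m "Suc m" "nat (fst s)"] Suc.prems
        by (auto simp: skew_def)
    qed (auto simp: skew_def)
    then show ?case using Suc by (simp add: lessThan_Suc)
  qed
  have disj: "skew (f (Suc i)) (f i) \<inter> skew (f (Suc j)) (f j) = {}" if "i < j" "j < n" for i j
  proof (rule equals0I)
    fix s assume "s \<in> skew (f (Suc i)) (f i) \<inter> skew (f (Suc j)) (f j)"
    then show False using mono[of "Suc i" j "nat (fst s)"] that by (auto simp: skew_def)
  qed
  have inj: "inj_on (\<lambda>i. skew (f (Suc i)) (f i)) {..<n}"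
  proof (rule inj_onI)
    fix i j assume "i \<in> {..<n}" "j \<in> {..<n}" "skew (f (Suc i)) (f i) = skew (f (Suc j)) (f j)"
    then show "i = j"
      using disj[of i j] disj[of j i] assms(2) by (cases i j rule: linorder_cases) auto
  qed
  have image: "{skew (f (Suc i)) (f i) | i. i < n} = (\<lambda>i. skew (f (Suc i)) (f i)) ` {..<n}" by auto
  show "card {skew (f (Suc i)) (f i) | i. i < n} = n"
    unfolding image using inj by (simp add: card_image)
  show "partition_on (skew (f n) (f 0)) {skew (f (Suc i)) (f i) | i. i < n}"
  proof (rule partition_onI)
    show "\<Union>{skew (f (Suc i)) (f i) | i. i < n} = skew (f n) (f 0)"
      unfolding image using union[of n] by simp
    fix S S' assume "S \<in> {skew (f (Suc i)) (f i) | i. i < n}"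
      "S' \<in> {skew (f (Suc i)) (f i) | i. i < n}" "S \<noteq> S'"
    then obtain i j where "i < n" "j < n" "S = skew (f (Suc i)) (f i)" "S' = skew (f (Suc j)) (f j)"
      "i \<noteq> j" by blast
    then show "disjnt S S'"
      using disj[of i j] disj[of j i] by (cases i j rule: linorder_cases) (auto simp: disjnt_def)
  qed (use assms(2) in auto)
qed

lemma
  assumes "bs_tableau lam mu T"
  shows bs_decomposition_of_tableau: "bs_decomposition lam mu (decomposition_of T)"
    and card_decomposition_of: "card (decomposition_of T) = length T - 1"
proof -
  have T: "T ! 0 = mu" "T ! (length T - 1) = lam"
    "\<And>i. Suc i < length T \<Longrightarrow> contained (T ! i) (T ! Suc i)"
    "\<And>i. Suc i < length T \<Longrightarrow> border_strip (skew (T ! Suc i) (T ! i))"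
    using assms by (auto simp: bs_tableau_def hd_conv_nth last_conv_nth)
  have D: "decomposition_of T = {skew (T ! Suc i) (T ! i) | i. i < length T - 1}"
    by (auto simp: decomposition_of_def less_diff_conv)
  have "contained (T ! i) (T ! Suc i)" "skew (T ! Suc i) (T ! i) \<noteq> {}" if "i < length T - 1" for i
    using T(3,4)[of i] that by (auto simp: border_strip_def)
  from partition_on_skew_chain[of "length T - 1" "(!) T", OF this]
  show "card (decomposition_of T) = length T - 1" "bs_decomposition lam mu (decomposition_of T)"
    unfolding bs_decomposition_def D T(1,2) using T(4) by auto
qed

text \<open>The square of content \<open>c\<close> in the strip of \<open>p\<close> is pushed down its diagonal, from the boundary of
  \<open>\<mu>\<close>, once for each earlier strip that contains content \<open>c\<close>.\<close>

definition placed_strip ::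
    "(nat \<Rightarrow> nat) \<Rightarrow> ((int \<times> int) \<times> (int \<times> int)) set \<Rightarrow> int \<times> int \<Rightarrow> square set" where
  "placed_strip \<mu> Q p = {(i, j). fst p < j - i \<and> j - i \<le> snd p \<and>
     i = int (beads_from \<mu> (j - i)) + int (card {q. (q, p) \<in> Q \<and> fst q < j - i \<and> j - i \<le> snd q}) + 1}"

text \<open>Any earlier strip that meets a diagonal of \<open>p\<close> overlaps \<open>p\<close>,
  so \<open>precedence\<close> records all the strips that push the squares of \<open>p\<close>
  down. Hence the decomposition depends on the ordering only through
  \<open>precedence\<close>.\<close>

lemma decomposition_of_bead_chain:
  assumes T: "bead_chain T ps" and dist: "distinct ps"
  shows "decomposition_of T = placed_strip (hd T) (precedence overlap ps) ` set ps"
proof -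
  have T0: "T ! 0 = hd T" using T by (cases T) (auto simp: bead_chain_def)
  have "skew (T ! Suc i) (T ! i) = placed_strip (hd T) (precedence overlap ps) (ps ! i)"
    if i: "i < length ps" for i
  proof -
    let ?p = "ps ! i"
    have before: "{q \<in> set (take i ps). fst q < c \<and> c \<le> snd q} =
        {q. (q, ?p) \<in> precedence overlap ps \<and> fst q < c \<and> c \<le> snd q}"
      if c: "fst ?p < c" "c \<le> snd ?p" for c
    proof (intro equalityI subsetI)
      fix q assume q: "q \<in> {q \<in> set (take i ps). fst q < c \<and> c \<le> snd q}"
      then obtain k where k: "k < i" "q = ps ! k" using i by (auto simp: in_set_conv_nth)
      have "overlap q ?p" using q c by (simp add: overlap_def)
      then show "q \<in> {q. (q, ?p) \<in> precedence overlap ps \<and> fst q < c \<and> c \<le> snd q}"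
        using nth_mem_precedence[of k i ps overlap] k i q by simp
    next
      fix q assume q: "q \<in> {q. (q, ?p) \<in> precedence overlap ps \<and> fst q < c \<and> c \<le> snd q}"
      then have "(q, ?p) \<in> precedence overlap ps" by simp
      then obtain k l where "k < l" "l < length ps" "q = ps ! k" "?p = ps ! l"
        by (rule precedence_nthE)
      then have "k < i" "q = ps ! k" using dist i by (simp_all add: nth_eq_iff_index_eq)
      then have "q \<in> set (take i ps)" using i by (auto simp: in_set_conv_nth)
      then show "q \<in> {q \<in> set (take i ps). fst q < c \<and> c \<le> snd q}" using q by simp
    qed
    have "skew (T ! Suc i) (T ! i) =
        {(x, y). fst ?p < y - x \<and> y - x \<le> snd ?p \<and> x = int (beads_from (T ! i) (y - x)) + 1}"
      using bead_chain_nth[OF T] i by (intro skew_bead_move) simp_all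
    also have "\<dots> = placed_strip (hd T) (precedence overlap ps) ?p"
      using before beads_from_bead_chain[OF T dist, of i] i T0 by (auto simp: placed_strip_def)
    finally show ?thesis .
  qed
  moreover have "Suc i < length T \<longleftrightarrow> i < length ps" for i using T by (simp add: bead_chain_def)
  ultimately have "decomposition_of T =
      {placed_strip (hd T) (precedence overlap ps) (ps ! i) | i. i < length ps}"
    unfolding decomposition_of_def by (metis (no_types, lifting))
  then show ?thesis by (simp only: set_conv_nth image_Collect) blast
qed

text \<open>Every strip before \<open>q\<close> on diagonal \<open>c\<close> is also before
  \<open>p\<close>, overlap being guaranteed by the shared content \<open>c\<close>, and
  \<open>q\<close> itself is one more. So the later strip lies strictly deeper on a shared
  diagonal.\<close>

lemma card_before_strict_mono:
  assumes "distinct ps" "(q, p) \<in> precedence overlap ps"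
    and "fst p < c" "c \<le> snd p" "fst q < c" "c \<le> snd q"
  shows "card {r. (r, q) \<in> precedence overlap ps \<and> fst r < c \<and> c \<le> snd r} <
    card {r. (r, p) \<in> precedence overlap ps \<and> fst r < c \<and> c \<le> snd r}"
proof (rule psubset_card_mono)
  have "{r. (r, p) \<in> precedence overlap ps \<and> fst r < c \<and> c \<le> snd r} \<subseteq> set ps"
    using precedence_subset[of overlap ps] by auto
  then show "finite {r. (r, p) \<in> precedence overlap ps \<and> fst r < c \<and> c \<le> snd r}"
    by (rule finite_subset) simp
  have "(r, p) \<in> precedence overlap ps"
    if "(r, q) \<in> precedence overlap ps" "fst r < c" "c \<le> snd r" for r
    using precedence_trans[OF assms(1) that(1) assms(2)] that assms(3,4) by (simp add: overlap_def)
  moreover have "(q, q) \<notin> precedence overlap ps" using precedence_asym[OF assms(1)] by blast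
  ultimately show "{r. (r, q) \<in> precedence overlap ps \<and> fst r < c \<and> c \<le> snd r} \<subset>
      {r. (r, p) \<in> precedence overlap ps \<and> fst r < c \<and> c \<le> snd r}"
    using assms by blast
qed

lemma inj_on_placed_strips:
  assumes pos: "\<And>p. p \<in> I \<Longrightarrow> fst p < snd p"
  shows "inj_on (\<lambda>Q. placed_strip \<mu> Q ` I) (precedence overlap ` permutations_of_set I)"
proof -
  let ?n = "\<lambda>Q p c. card {r. (r, p) \<in> Q \<and> fst r < c \<and> c \<le> snd r}"
  have mem: "(i, i + c) \<in> placed_strip \<mu> Q p \<longleftrightarrow>
      fst p < c \<and> c \<le> snd p \<and> i = int (beads_from \<mu> c) + int (?n Q p c) + 1" for Q p i c
    by (simp add: placed_strip_def)
  have contents: "content ` placed_strip \<mu> Q p = {fst p<..snd p}" for Q p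
  proof (intro equalityI subsetI)
    fix c assume "c \<in> {fst p<..snd p}"
    then have "(int (beads_from \<mu> c) + int (?n Q p c) + 1,
        int (beads_from \<mu> c) + int (?n Q p c) + 1 + c) \<in> placed_strip \<mu> Q p"
      by (simp add: mem)
    then show "c \<in> content ` placed_strip \<mu> Q p" by (rule rev_image_eqI) simp
  qed (auto simp: placed_strip_def)
  have counts: "?n Q p c = ?n Q' p c"
    if eq: "placed_strip \<mu> Q ` I = placed_strip \<mu> Q' ` I" and p: "p \<in> I" "fst p < c" "c \<le> snd p"
    for Q Q' p c
  proof -
    \<comment> \<open>Equal families match strips in some unknown way; a strip reveals its interval
      by its range of contents, so the strip of \<open>p\<close> is matched with the strip of
      \<open>p\<close>.\<close>
    obtain p' where p': "p' \<in> I" "placed_strip \<mu> Q p = placed_strip \<mu> Q' p'"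
      using eq p(1) by (metis imageE imageI)
    then have "{fst p<..snd p} = {fst p'<..snd p'}" by (metis contents)
    then have "p = p'" using pos[OF p(1)] pos[OF p'(1)]
      by (intro prod_eqI) (auto simp: Ioc_inj)
    then have "placed_strip \<mu> Q p = placed_strip \<mu> Q' p" using p' by simp
    then show ?thesis
      using mem[of "int (beads_from \<mu> c) + int (?n Q p c) + 1" c Q p]
        mem[of "int (beads_from \<mu> c) + int (?n Q p c) + 1" c Q' p] p by simp
  qed
  have sub: "precedence overlap ps \<subseteq> precedence overlap ps'"
    if ps: "ps \<in> permutations_of_set I" and ps': "ps' \<in> permutations_of_set I"
      and eq: "placed_strip \<mu> (precedence overlap ps) ` I = placed_strip \<mu> (precedence overlap ps') ` I"
    for ps ps'
  proof (rule subsetI, rule ccontr)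
    have d: "distinct ps" "distinct ps'" "set ps = I" "set ps' = I"
      using ps ps' by (auto simp: permutations_of_set_def)
    fix x assume "x \<in> precedence overlap ps" "x \<notin> precedence overlap ps'"
    then obtain q p where qp: "(q, p) \<in> precedence overlap ps" "(q, p) \<notin> precedence overlap ps'"
      by (cases x) auto
    then have I: "q \<in> I" "p \<in> I" "overlap q p" using precedence_subset[of overlap ps] d by auto
    moreover have "q \<noteq> p" using qp(1) precedence_asym[OF d(1)] by blast
    ultimately have pq: "(p, q) \<in> precedence overlap ps'"
      using precedence_total[of q ps' p overlap] qp(2) d by (auto simp: overlap_def)
    \<comment> \<open>The first content common to both strips; the two orderings give opposite
      depths there.\<close>
    define c where "c = max (fst p) (fst q) + 1"
    have c: "fst p < c" "c \<le> snd p" "fst q < c" "c \<le> snd q"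
      using I pos[OF I(1)] pos[OF I(2)] by (auto simp: c_def overlap_def)
    show False
      using card_before_strict_mono[OF d(1) qp(1) c] card_before_strict_mono[OF d(2) pq c(3,4,1,2)]
        counts[OF eq I(1) c(3,4)] counts[OF eq I(2) c(1,2)] by simp
  qed
  show ?thesis
  proof (rule inj_onI)
    fix Q Q' assume "Q \<in> precedence overlap ` permutations_of_set I"
      "Q' \<in> precedence overlap ` permutations_of_set I"
      and eq: "placed_strip \<mu> Q ` I = placed_strip \<mu> Q' ` I"
    then obtain ps ps' where ps: "ps \<in> permutations_of_set I" "Q = precedence overlap ps"
      and ps': "ps' \<in> permutations_of_set I" "Q' = precedence overlap ps'"
      by (elim imageE)
    from sub[OF ps(1) ps'(1)] sub[OF ps'(1) ps(1)] show "Q = Q'"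
      using eq unfolding ps(2) ps'(2) by (intro equalityI) simp_all
  qed
qed

section \<open>The minimal tableaux of an interval set\<close>

lemma bead_chain_of_matching_exists:
  assumes mu: "is_partition mu" and ps: "ps \<in> permutations_of_set I"
    and I: "I \<in> rising_matchings (beads mu - beads lam) (beads lam - beads mu)"
  shows "\<exists>T. bead_chain T ps \<and> hd T = mu"
proof (rule bead_chain_exists[OF mu])
  have M: "fst ` I = beads mu - beads lam" "snd ` I = beads lam - beads mu"
    "inj_on fst I" "inj_on snd I" "\<forall>p\<in>I. fst p < snd p"
    using I by (simp_all add: rising_matchings_def)
  have d: "set ps = I" "distinct ps" using ps by (simp_all add: permutations_of_set_def)
  show "fst ` set ps \<subseteq> beads mu" "snd ` set ps \<inter> beads mu = {}" unfolding d(1) M(1,2) by blast+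
  show "distinct (map fst ps)" "distinct (map snd ps)" using M(3,4) d by (simp_all add: distinct_map)
  show "\<forall>p\<in>set ps. fst p < snd p" unfolding d(1) by (rule M(5))
qed

text \<open>A chain that uses each interval once ends in \<open>lam\<close> and has as many strips
  as the rank, which no decomposition can undercut.\<close>

lemma minimal_tableaux_for_eq:
  assumes lam: "is_partition lam" and mu: "is_partition mu" and cont: "contained mu lam"
    and I: "I \<in> rising_matchings (beads mu - beads lam) (beads lam - beads mu)"
  shows "minimal_tableaux_for lam mu I =
    {T. hd T = mu \<and> (\<exists>ps\<in>permutations_of_set I. bead_chain T ps)}"
proof -
  let ?A = "beads mu - beads lam" and ?B = "beads lam - beads mu"
  have M: "fst ` I = ?A" "snd ` I = ?B" "inj_on fst I" "inj_on snd I" "\<forall>p\<in>I. fst p < snd p"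
    using I by (simp_all add: rising_matchings_def)
  have fin: "finite I" using M(1,3) finite_beads_diff[OF lam mu cont] by (metis finite_image_iff)
  have "card I = card ?A" using M(1,3) by (metis card_image)
  then have rank: "int (card I) = skew_rank lam mu" using card_beads_diff[OF lam mu cont] by simp
  have minimal: "minimal_bs_tableau lam mu T"
    if T: "bead_chain T ps" "hd T = mu" and ps: "ps \<in> permutations_of_set I" for T ps
  proof -
    have d: "set ps = I" "distinct ps" "length ps = card I"
      using ps by (auto simp: permutations_of_set_def distinct_card)
    have T0: "T ! 0 = mu" using T by (cases T) (auto simp: bead_chain_def)
    have "beads (T ! length ps) = (beads mu - ?A) \<union> ?B"
      using beads_bead_chain[OF T(1), of "length ps"] d M(1,2) T0 by auto
    then have "beads (T ! length ps) = beads lam" by auto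
    then have "T ! length ps = lam"
      using inj_on_beads_partition bead_chain_nth(1)[OF T(1), of "length ps"] lam
      by (simp add: inj_on_def)
    moreover have "last T = T ! length ps" using T(1) by (subst last_conv_nth) (auto simp: bead_chain_def)
    ultimately have tab: "bs_tableau lam mu T" using T bs_tableau_iff_bead_chain by metis
    have "card (decomposition_of T) = card I"
      using card_decomposition_of[OF tab] T(1) d(3) by (simp add: bead_chain_def)
    then have "card (decomposition_of T) \<le> card D'" if "bs_decomposition lam mu D'" for D'
      using skew_rank_le_card_decomposition[OF lam mu cont that] rank by simp
    then show ?thesis
      using tab bs_decomposition_of_tableau
      by (simp add: minimal_bs_tableau_def minimal_bs_decomposition_def)
  qed
  show ?thesis
  proof (intro equalityI subsetI)
    fix T assume "T \<in> minimal_tableaux_for lam mu I"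
    then have T: "bs_tableau lam mu T" "minimal_bs_decomposition lam mu (decomposition_of T)"
      "intervals_of T = I"
      by (auto simp: minimal_tableaux_for_def minimal_bs_tableau_def)
    then obtain ps where ps: "bead_chain T ps" "hd T = mu" by (auto simp: bs_tableau_iff_bead_chain)
    \<comment> \<open>\<open>intervals_of\<close> is a set and forgets repetitions. The tableau of
      an arbitrary ordering \<open>qs\<close> serves as a yardstick: by minimality \<open>T\<close>
      has at most \<open>card I\<close> steps, so its moves are distinct.\<close>
    obtain qs where qs: "qs \<in> permutations_of_set I"
      using fin by (metis permutations_of_set_empty_iff ex_in_conv)
    obtain S where S: "bead_chain S qs" "hd S = mu" using bead_chain_of_matching_exists[OF mu qs I] by blast
    have tab: "bs_tableau lam mu S" using minimal[OF S qs] by (simp add: minimal_bs_tableau_def)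
    have "card (decomposition_of T) \<le> card (decomposition_of S)"
      using T(2) bs_decomposition_of_tableau[OF tab] by (simp add: minimal_bs_decomposition_def)
    moreover have "card (decomposition_of S) = length qs"
      using card_decomposition_of[OF tab] S(1) by (simp add: bead_chain_def)
    moreover have "length qs = card I" using qs by (simp add: length_finite_permutations_of_set)
    moreover have "card (decomposition_of T) = length ps"
      using card_decomposition_of[OF T(1)] ps(1) by (simp add: bead_chain_def)
    moreover have "set ps = I" using intervals_of_bead_chain[OF ps(1)] T(3) by simp
    ultimately have "distinct ps" using card_length[of ps] by (simp add: card_distinct)
    then have "ps \<in> permutations_of_set I" using \<open>set ps = I\<close> by (simp add: permutations_of_set_def)
    then show "T \<in> {T. hd T = mu \<and> (\<exists>ps\<in>permutations_of_set I. bead_chain T ps)}" using ps by auto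
  next
    fix T assume "T \<in> {T. hd T = mu \<and> (\<exists>ps\<in>permutations_of_set I. bead_chain T ps)}"
    then obtain ps where ps: "hd T = mu" "ps \<in> permutations_of_set I" "bead_chain T ps" by auto
    then have "intervals_of T = I"
      using intervals_of_bead_chain by (auto simp: permutations_of_set_def)
    then show "T \<in> minimal_tableaux_for lam mu I"
      using minimal[OF ps(3,1,2)] by (simp add: minimal_tableaux_for_def)
  qed
qed

lemma bij_betw_bead_chain:
  assumes lam: "is_partition lam" and mu: "is_partition mu" and cont: "contained mu lam"
    and I: "I \<in> rising_matchings (beads mu - beads lam) (beads lam - beads mu)"
  shows "bij_betw moves_of (minimal_tableaux_for lam mu I) (permutations_of_set I)"
  unfolding minimal_tableaux_for_eq[OF assms]
proof (rule bij_betwI')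
  fix T T' assume "T \<in> {T. hd T = mu \<and> (\<exists>ps\<in>permutations_of_set I. bead_chain T ps)}"
    "T' \<in> {T. hd T = mu \<and> (\<exists>ps\<in>permutations_of_set I. bead_chain T ps)}"
  then obtain ps ps' where "bead_chain T ps" "bead_chain T' ps'" "hd T = hd T'" by auto
  then show "moves_of T = moves_of T' \<longleftrightarrow> T = T'"
    using moves_of_bead_chain bead_chain_unique by metis
next
  fix T assume "T \<in> {T. hd T = mu \<and> (\<exists>ps\<in>permutations_of_set I. bead_chain T ps)}"
  then show "moves_of T \<in> permutations_of_set I" using moves_of_bead_chain by auto
next
  fix ps assume ps: "ps \<in> permutations_of_set I"
  from bead_chain_of_matching_exists[OF mu this I]
  have "\<exists>T. bead_chain T ps \<and> hd T = mu" .
  then show "\<exists>T\<in>{T. hd T = mu \<and> (\<exists>ps\<in>permutations_of_set I. bead_chain T ps)}.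
      ps = moves_of T"
    using moves_of_bead_chain ps by auto
qed

theorem theorem4p8:
  fixes lam mu :: "nat \<Rightarrow> nat" and I :: "(int \<times> int) set"
  assumes "is_partition lam" and "is_partition mu" and "contained mu lam"
    and "interval_set lam mu I"
  shows "card (minimal_tableaux_for lam mu I) = fact (nat (skew_rank lam mu)) \<and>
    card (decomposition_of ` minimal_tableaux_for lam mu I) = num_interval_sets lam mu"
proof
  let ?M = "rising_matchings (beads mu - beads lam) (beads lam - beads mu)"
  let ?T = "minimal_tableaux_for lam mu I" and ?P = "permutations_of_set I"
  have I: "I \<in> ?M" using assms(4) by (simp add: interval_set_iff[OF assms(1-3)])
  have fin: "finite I" and rank: "int (card I) = skew_rank lam mu"
    using assms(4) by (auto simp: interval_set_def)
  have bij: "bij_betw moves_of ?T ?P"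
    by (rule bij_betw_bead_chain[OF assms(1-3) I])
  show "card ?T = fact (nat (skew_rank lam mu))"
    using bij_betw_same_card[OF bij] fin by (simp add: rank[symmetric])
  have pos: "fst p < snd p" if "p \<in> I" for p using I that by (simp add: rising_matchings_def)
  \<comment> \<open>The map to decompositions factors as tableau, ordering, precedence, family of
    strips. The first arrow is bijective and the last injective, so only the precedences remain to
    be counted.\<close>
  have "decomposition_of T = placed_strip mu (precedence overlap (moves_of T)) ` I"
    if T: "T \<in> ?T" for T
  proof -
    obtain ps where ps: "hd T = mu" "ps \<in> ?P" "bead_chain T ps"
      using T minimal_tableaux_for_eq[OF assms(1-3) I] by auto
    moreover have "moves_of T = ps" by (rule moves_of_bead_chain[OF ps(3)])
    ultimately show ?thesis
      using decomposition_of_bead_chain[OF ps(3)] by (simp add: permutations_of_set_def)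
  qed
  then have "decomposition_of ` ?T =
      (\<lambda>T. placed_strip mu (precedence overlap (moves_of T)) ` I) ` ?T"
    by (rule image_cong[OF refl])
  also have "\<dots> = (\<lambda>Q. placed_strip mu Q ` I) ` precedence overlap ` moves_of ` ?T"
    by (simp only: image_image)
  also have "\<dots> = (\<lambda>Q. placed_strip mu Q ` I) ` precedence overlap ` ?P"
    by (simp only: bij_betw_imp_surj_on[OF bij])
  finally have "card (decomposition_of ` ?T) = card (precedence overlap ` ?P)"
    using card_image[OF inj_on_placed_strips[where \<mu> = mu, OF pos]] by simp
  also have "\<dots> = card ?M" by (rule card_precedence_eq_card_rising_matchings[OF fin I])
  also have "\<dots> = num_interval_sets lam mu"
    using interval_set_iff[OF assms(1-3)] by (simp add: num_interval_sets_def)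
  finally show "card (decomposition_of ` ?T) = num_interval_sets lam mu" .
qed

end
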